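(* Let $n \geq 3$. If $t, t' \in \Xi_n$ are close vertices, then $m(t,t') = r_{n-2}$ (independent of $t$ and $t'$), where $m(t,t')$ is the number of galleries of length $1$ in $\Xi_n$ whose initial chamber contains $t$ and whose ending chamber contains $t'$. In particular, $\omega_n = (r_n \cdot q)/r_{n-2}$, where $\omega_n$ is the number of vertices in $\Xi_n$ close to a given vertex of $\Xi_n$.
   Context: $K$ is a (nonarchimedean) local field with discrete valuation $\mathrm{ord}$, valuation ring $\mathcal{O}$, uniformizer $\pi$ and residue field $k \cong \mathbb{F}_q$. A lattice in a finite-dimensional $K$-vector space $V$ is a free $\mathcal{O}$-submodule of $V$ of rank $\dim_K V$; lattices $L, L'$ in $V$ are homothetic if $L' = \alpha L$ for some $\alpha \in K^\times$, and $[L]$ denotes the homothety class of $L$. For an integer $m\ge 2$, the affine building $\Xi_m$ of $\mathrm{SL}_m(K)$ is the following simplicial complex of dimension $m-1$. Fix an $m$-dimensional $K$-vector space $V$. Vertices are homothety classes of lattices in $V$. Vertices $t,t'$ are incident if there are $L \in t$, $L' \in t'$ with $\pi L \subseteq L' \subseteq L$. Simplices are the finite sets of pairwise incident vertices. A chamber is a maximal simplex; it has $m$ vertices $t_0,\dots,t_{m-1}$ with representatives $L_i \in t_i$ such that $\pi L_0 \subsetneq L_1 \subsetneq \cdots \subsetneq L_{m-1} \subsetneq L_0$ and $[L_1:\pi L_0] = q = [L_i : L_{i-1}]$ for $2 \le i \le m-1$. Two chambers are adjacent if they share a codimension-one face. A gallery of length $1$ is an ordered pair $C, C'$ of adjacent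 chambers. Two vertices $t,t'$ are close if there are adjacent chambers $C, C'$ with $t \in C$, $t' \in C'$, but $t,t' \notin C \cap C'$. For $m\ge 2$, $r_m$ is the number of chambers in $\Xi_m$ containing a given vertex of $\Xi_m$, and $r_1 := 1$. The numbers $r_m$ and $\omega_n$ do not depend on the chosen vertex. *)

theory Defs
  imports Complex_Main "HOL-Library.Function_Algebras"
begin

section \<open>Nonarchimedean local fields\<close>

text \<open>The value of the valuation at \<open>0\<close> (which should be infinite) is left unspecified; every
  use of \<open>ord x\<close> below is guarded by \<open>x \<noteq> 0\<close> or has \<open>x = 0\<close> as a separate alternative.\<close>

definition valuation_ring :: "('k::field \<Rightarrow> int) \<Rightarrow> 'k set" where
  "valuation_ring ord = {x. x = 0 \<or> ord x \<ge> 0}"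

definition maximal_ideal :: "('k::field \<Rightarrow> int) \<Rightarrow> 'k set" where
  "maximal_ideal ord = {x. x = 0 \<or> ord x > 0}"

definition residue_field :: "('k::field \<Rightarrow> int) \<Rightarrow> 'k set set" where
  "residue_field ord = valuation_ring ord //
     {(x, y). x \<in> valuation_ring ord \<and> y \<in> valuation_ring ord \<and> x - y \<in> maximal_ideal ord}"

definition uniformizer :: "('k::field \<Rightarrow> int) \<Rightarrow> 'k \<Rightarrow> bool" where
  "uniformizer ord \<pi> \<longleftrightarrow> \<pi> \<noteq> 0 \<and> ord \<pi> = 1"

text \<open>A field that is complete for a normalized discrete valuation with finite residue field.\<close>

locale nonarch_local_field =
  fixes ord :: "'k::field \<Rightarrow> int"
  assumes ord_mult: "x \<noteq> 0 \<Longrightarrow> y \<noteq> 0 \<Longrightarrow> ord (x * y) = ord x + ord y"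
    and ord_add: "x \<noteq> 0 \<Longrightarrow> y \<noteq> 0 \<Longrightarrow> x + y \<noteq> 0 \<Longrightarrow> ord (x + y) \<ge> min (ord x) (ord y)"
    and uniformizer_exists: "\<exists>\<pi>. uniformizer ord \<pi>"
    and complete:
      "\<And>X :: nat \<Rightarrow> 'k.
         (\<forall>N. \<exists>M. \<forall>i\<ge>M. \<forall>j\<ge>M. X i = X j \<or> ord (X i - X j) \<ge> N) \<Longrightarrow>
         \<exists>x. \<forall>N. \<exists>M. \<forall>i\<ge>M. X i = x \<or> ord (X i - x) \<ge> N"
    and finite_residue_field: "finite (residue_field ord)"


section \<open>Lattices\<close>

text \<open>Throughout, \<open>V\<close> is a linear subspace of an ambient \<open>K\<close>-vector space with scalar
  multiplication \<open>scale\<close>. A lattice in \<open>V\<close> is an \<open>\<O>\<close>-submodule of \<open>V\<close> having an \<open>\<O>\<close>-basis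
  of \<open>dim V\<close> elements.\<close>

definition is_lattice ::
  "('k::field \<Rightarrow> int) \<Rightarrow> ('k \<Rightarrow> 'v::ab_group_add \<Rightarrow> 'v) \<Rightarrow> 'v set \<Rightarrow> 'v set \<Rightarrow> bool" where
  "is_lattice ord scale V L \<longleftrightarrow>
     (\<exists>B. finite B \<and> B \<subseteq> V \<and> card B = vector_space.dim scale V \<and>
        (\<forall>a. a ` B \<subseteq> valuation_ring ord \<longrightarrow> (\<Sum>b\<in>B. scale (a b) b) = 0 \<longrightarrow> (\<forall>b\<in>B. a b = 0)) \<and>
        L = {\<Sum>b\<in>B. scale (a b) b | a. a ` B \<subseteq> valuation_ring ord})"

definition homothety_class ::
  "('k::field \<Rightarrow> 'v::ab_group_add \<Rightarrow> 'v) \<Rightarrow> 'v set \<Rightarrow> 'v set set" where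
  "homothety_class scale L = {scale \<alpha> ` L | \<alpha>. \<alpha> \<noteq> 0}"


section \<open>The affine building of \<open>SL\<^sub>m(K)\<close>\<close>

definition building_vertices ::
  "('k::field \<Rightarrow> int) \<Rightarrow> ('k \<Rightarrow> 'v::ab_group_add \<Rightarrow> 'v) \<Rightarrow> 'v set \<Rightarrow> 'v set set set" where
  "building_vertices ord scale V = {homothety_class scale L | L. is_lattice ord scale V L}"

definition incident ::
  "'k::field \<Rightarrow> ('k \<Rightarrow> 'v::ab_group_add \<Rightarrow> 'v) \<Rightarrow> 'v set set \<Rightarrow> 'v set set \<Rightarrow> bool" where
  "incident \<pi> scale t t' \<longleftrightarrow> (\<exists>L\<in>t. \<exists>L'\<in>t'. scale \<pi> ` L \<subseteq> L' \<and> L' \<subseteq> L)"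

definition building_simplex ::
  "('k::field \<Rightarrow> int) \<Rightarrow> 'k \<Rightarrow> ('k \<Rightarrow> 'v::ab_group_add \<Rightarrow> 'v) \<Rightarrow> 'v set \<Rightarrow> 'v set set set \<Rightarrow> bool" where
  "building_simplex ord \<pi> scale V S \<longleftrightarrow>
     finite S \<and> S \<subseteq> building_vertices ord scale V \<and> pairwise (incident \<pi> scale) S"

definition chamber ::
  "('k::field \<Rightarrow> int) \<Rightarrow> 'k \<Rightarrow> ('k \<Rightarrow> 'v::ab_group_add \<Rightarrow> 'v) \<Rightarrow> 'v set \<Rightarrow> 'v set set set \<Rightarrow> bool" where
  "chamber ord \<pi> scale V C \<longleftrightarrow>
     building_simplex ord \<pi> scale V C \<and>
     (\<forall>S. building_simplex ord \<pi> scale V S \<and> C \<subseteq> S \<longrightarrow> S = C)"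

definition adjacent ::
  "('k::field \<Rightarrow> int) \<Rightarrow> 'k \<Rightarrow> ('k \<Rightarrow> 'v::ab_group_add \<Rightarrow> 'v) \<Rightarrow> 'v set \<Rightarrow>
     'v set set set \<Rightarrow> 'v set set set \<Rightarrow> bool" where
  "adjacent ord \<pi> scale V C C' \<longleftrightarrow>
     chamber ord \<pi> scale V C \<and> chamber ord \<pi> scale V C' \<and> C \<noteq> C' \<and>
     (\<exists>F. F \<subseteq> C \<and> F \<subseteq> C' \<and> card F + 1 = card C \<and> card F + 1 = card C')"

definition close_vertices ::
  "('k::field \<Rightarrow> int) \<Rightarrow> 'k \<Rightarrow> ('k \<Rightarrow> 'v::ab_group_add \<Rightarrow> 'v) \<Rightarrow> 'v set \<Rightarrow>
     'v set set \<Rightarrow> 'v set set \<Rightarrow> bool" where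
  "close_vertices ord \<pi> scale V t t' \<longleftrightarrow>
     (\<exists>C C'. adjacent ord \<pi> scale V C C' \<and> t \<in> C \<and> t' \<in> C' \<and> t \<notin> C \<inter> C' \<and> t' \<notin> C \<inter> C')"

text \<open>The galleries of length \<open>1\<close> counted by \<open>m(t, t')\<close>.\<close>

definition galleries_between ::
  "('k::field \<Rightarrow> int) \<Rightarrow> 'k \<Rightarrow> ('k \<Rightarrow> 'v::ab_group_add \<Rightarrow> 'v) \<Rightarrow> 'v set \<Rightarrow>
     'v set set \<Rightarrow> 'v set set \<Rightarrow> ('v set set set \<times> 'v set set set) set" where
  "galleries_between ord \<pi> scale V t t' =
     {(C, C'). adjacent ord \<pi> scale V C C' \<and> t \<in> C \<and> t' \<in> C'}"

definition vertices_close_to ::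
  "('k::field \<Rightarrow> int) \<Rightarrow> 'k \<Rightarrow> ('k \<Rightarrow> 'v::ab_group_add \<Rightarrow> 'v) \<Rightarrow> 'v set \<Rightarrow>
     'v set set \<Rightarrow> 'v set set set" where
  "vertices_close_to ord \<pi> scale V t =
     {t' \<in> building_vertices ord scale V. close_vertices ord \<pi> scale V t t'}"

definition chambers_containing ::
  "('k::field \<Rightarrow> int) \<Rightarrow> 'k \<Rightarrow> ('k \<Rightarrow> 'v::ab_group_add \<Rightarrow> 'v) \<Rightarrow> 'v set \<Rightarrow>
     'v set set \<Rightarrow> 'v set set set set" where
  "chambers_containing ord \<pi> scale V t = {C. chamber ord \<pi> scale V C \<and> t \<in> C}"


section \<open>The numbers \<open>r\<^sub>m\<close>\<close>

text \<open>To let the dimension vary, \<open>K\<^sup>m\<close> is modelled by the sequences vanishing from index \<open>m\<close> on.\<close>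

definition coord_scale :: "'k::field \<Rightarrow> (nat \<Rightarrow> 'k) \<Rightarrow> nat \<Rightarrow> 'k" where
  "coord_scale c f = (\<lambda>i. c * f i)"

definition coord_space :: "nat \<Rightarrow> (nat \<Rightarrow> 'k::field) set" where
  "coord_space m = {f. \<forall>i\<ge>m. f i = 0}"

text \<open>For \<open>m \<ge> 2\<close> this is the common number of chambers through the vertices of the building
  of \<open>K\<^sup>m\<close>.\<close>

definition r_num :: "('k::field \<Rightarrow> int) \<Rightarrow> 'k \<Rightarrow> nat \<Rightarrow> nat" where
  "r_num ord \<pi> m =
     (if m = 1 then 1
      else (THE N. \<forall>t \<in> building_vertices ord coord_scale (coord_space m).
              finite (chambers_containing ord \<pi> coord_scale (coord_space m) t) \<and>
              card (chambers_containing ord \<pi> coord_scale (coord_space m) t) = N))"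

end

theory Submission
  imports Defs
begin

text \<open>
  Everything is read off from the \<open>\<O>\<close>-submodules squeezed between \<open>\<pi>L\<close> and a lattice \<open>L\<close>. Each of
  them is a lattice, and a vertex incident to \<open>[L]\<close> has a representative there that is unique up
  to identifying \<open>\<pi>L\<close> with \<open>L\<close>; two such vertices are incident exactly if the representatives are
  comparable. So the chambers through \<open>[L]\<close> are the maximal chains of submodules from \<open>\<pi>L\<close> to
  \<open>L\<close>, the complete flags of \<open>L/\<pi>L\<close>. The index takes the place of the dimension over the
  residue field: \<open>A \<subseteq> B\<close> with \<open>\<pi>B \<subseteq> A\<close> and index \<open>q\<^sup>d\<close> admits as many maximal
  chains as a space of dimension \<open>d\<close> has complete flags (\<open>card_maxchains\<close>). In particular \<open>r\<^sub>m\<close>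
  is the number of complete flags in dimension \<open>m\<close>, which is also right for \<open>m = 1\<close>.

  A gallery from \<open>t = [L]\<close> to a close vertex \<open>t'\<close> is given by the common face \<open>F\<close> of its two
  chambers. Such an \<open>F\<close> completes \<open>t\<close> to a maximal chain, so it is the image of a maximal chain
  from the successor \<open>Q\<close> of \<open>\<pi>L\<close> to the predecessor \<open>P\<close> of \<open>L\<close>. On the other side \<open>t'\<close> has a
  representative \<open>Y\<close> strictly between \<open>\<pi>P\<close> and \<open>Q\<close>, a pair of index \<open>q\<^sup>2\<close> that also encloses
  \<open>\<pi>L\<close>: otherwise one would lie between \<open>Q\<close> and \<open>P\<close>, hence between \<open>\<pi>L\<close> and \<open>L\<close>, and \<open>t\<close> could be
  added to the chamber formed by \<open>t'\<close> and \<open>F\<close>. Consequently \<open>\<pi>P = \<pi>L \<inter> Y\<close> and \<open>Q = \<pi>L + Y\<close>, so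
  \<open>P\<close> and \<open>Q\<close> are determined by \<open>t\<close> and \<open>t'\<close>, while the chain from \<open>Q\<close> to \<open>P\<close> is arbitrary
  (\<open>card_panels\<close>). As \<open>Q\<close> has index \<open>q\<^sup>n\<^sup>-\<^sup>2\<close> in \<open>P\<close>, there are \<open>r\<^sub>n\<^sub>-\<^sub>2\<close> galleries.

  Conversely, a chamber through \<open>t\<close> fixes \<open>P\<close> and \<open>Q\<close>. There are \<open>q + 1\<close> submodules strictly
  between \<open>\<pi>P\<close> and \<open>Q\<close>, and those other than \<open>\<pi>L\<close> give the \<open>q\<close> vertices that can replace \<open>t\<close>.
  Counting the pairs of a chamber and such a vertex in two ways yields \<open>\<omega>\<^sub>n r\<^sub>n\<^sub>-\<^sub>2 = r\<^sub>n q\<close>.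
\<close>


section \<open>The valuation ring\<close>

context nonarch_local_field
begin

abbreviation \<O> :: "'k set" where "\<O> \<equiv> valuation_ring ord"

abbreviation q :: nat where "q \<equiv> card (residue_field ord)"

lemma ord_1 [simp]: "ord 1 = 0"
  using ord_mult[of 1 1] by simp

lemma ord_uminus [simp]: "ord (- x) = ord x"
proof (cases "x = 0")
  case False
  have "ord (- 1) = 0"
    using ord_mult[of "- 1" "- 1"] by simp
  then show ?thesis
    using ord_mult[of "- 1" x] False by simp
qed simp

lemma ord_inverse: "x \<noteq> 0 \<Longrightarrow> ord (inverse x) = - ord x"
  using ord_mult[of x "inverse x"] by simp

lemma O_0 [simp]: "0 \<in> \<O>" and O_1 [simp]: "1 \<in> \<O>"
  by (auto simp: valuation_ring_def)

lemma O_add: "x \<in> \<O> \<Longrightarrow> y \<in> \<O> \<Longrightarrow> x + y \<in> \<O>"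
  using ord_add[of x y] by (fastforce simp: valuation_ring_def)

lemma O_mult: "x \<in> \<O> \<Longrightarrow> y \<in> \<O> \<Longrightarrow> x * y \<in> \<O>"
  using ord_mult[of x y] by (cases "x = 0 \<or> y = 0") (auto simp: valuation_ring_def)

lemma O_uminus: "x \<in> \<O> \<Longrightarrow> - x \<in> \<O>"
  by (auto simp: valuation_ring_def)

lemma O_diff: "x \<in> \<O> \<Longrightarrow> y \<in> \<O> \<Longrightarrow> x - y \<in> \<O>"
  using O_add[of x "- y"] O_uminus[of y] by simp

lemma O_divide: "y \<noteq> 0 \<Longrightarrow> x = 0 \<or> ord y \<le> ord x \<Longrightarrow> x / y \<in> \<O>"
  using ord_mult[of x "inverse y"] ord_inverse[of y]
  by (cases "x = 0") (auto simp: valuation_ring_def divide_inverse)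

lemma unit_iff: "c \<in> \<O> - maximal_ideal ord \<longleftrightarrow> c \<noteq> 0 \<and> c \<in> \<O> \<and> inverse c \<in> \<O>"
  using ord_inverse[of c] by (auto simp: valuation_ring_def maximal_ideal_def)

lemma residue_field_eq_image:
  "residue_field ord = (\<lambda>c. {d \<in> \<O>. c - d \<in> maximal_ideal ord}) ` \<O>"
  by (auto simp: residue_field_def quotient_def Image_def)

lemma maximal_ideal_diff:
  "x \<in> maximal_ideal ord \<Longrightarrow> y \<in> maximal_ideal ord \<Longrightarrow> x - y \<in> maximal_ideal ord"
  using ord_add[of x "- y"] by (fastforce simp: maximal_ideal_def)

lemma residue_class_eq_iff:
  assumes "c \<in> \<O>" "d \<in> \<O>"
  shows "{e \<in> \<O>. c - e \<in> maximal_ideal ord} = {e \<in> \<O>. d - e \<in> maximal_ideal ord}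
    \<longleftrightarrow> c - d \<in> maximal_ideal ord"
proof
  assume "{e \<in> \<O>. c - e \<in> maximal_ideal ord} = {e \<in> \<O>. d - e \<in> maximal_ideal ord}"
  moreover have "d \<in> {e \<in> \<O>. d - e \<in> maximal_ideal ord}"
    using assms by (simp add: maximal_ideal_def)
  ultimately show "c - d \<in> maximal_ideal ord"
    by blast
next
  assume cd: "c - d \<in> maximal_ideal ord"
  have "c - e \<in> maximal_ideal ord \<longleftrightarrow> d - e \<in> maximal_ideal ord" for e
  proof
    assume "c - e \<in> maximal_ideal ord"
    from maximal_ideal_diff[OF this cd] show "d - e \<in> maximal_ideal ord" by simp
  next
    assume de: "d - e \<in> maximal_ideal ord"
    have "d - c \<in> maximal_ideal ord"
      using maximal_ideal_diff[OF _ cd, of 0] by (simp add: maximal_ideal_def)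
    from maximal_ideal_diff[OF de this] show "c - e \<in> maximal_ideal ord" by simp
  qed
  then show "{e \<in> \<O>. c - e \<in> maximal_ideal ord} = {e \<in> \<O>. d - e \<in> maximal_ideal ord}"
    by blast
qed

lemma q_ge_2: "q \<ge> 2"
proof -
  let ?cl = "\<lambda>c. {d \<in> \<O>. c - d \<in> maximal_ideal ord}"
  have "?cl 0 \<noteq> ?cl 1"
    using residue_class_eq_iff[of 0 1] by (simp add: maximal_ideal_def)
  then have "card {?cl 0, ?cl 1} = 2"
    by simp
  moreover have "{?cl 0, ?cl 1} \<subseteq> residue_field ord"
    unfolding residue_field_eq_image using O_0 O_1 by blast
  ultimately show ?thesis
    using card_mono[OF finite_residue_field] by metis
qed

end

text \<open>Cardinalities of quotients are compared throughout by exhibiting two maps on the same set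
  that identify the same points.\<close>

lemma bij_betw_images_of_same_kernel:
  assumes "\<And>x y. x \<in> S \<Longrightarrow> y \<in> S \<Longrightarrow> f x = f y \<longleftrightarrow> g x = g y"
  shows "bij_betw (\<lambda>y. g (inv_into S f y)) (f ` S) (g ` S)"
proof -
  have *: "inv_into S f (f x) \<in> S" "g (inv_into S f (f x)) = g x" if "x \<in> S" for x
  proof -
    show "inv_into S f (f x) \<in> S"
      using that by (simp add: inv_into_into)
    then show "g (inv_into S f (f x)) = g x"
      using that assms f_inv_into_f[of "f x" f S] by blast
  qed
  then show ?thesis
    using assms by (auto simp: bij_betw_def inj_on_def image_image cong: image_cong)
qed


section \<open>Modules over the valuation ring\<close>

locale lattice_space = nonarch_local_field ord + vector_space scale
  for ord :: "'k::field \<Rightarrow> int" and scale :: "'k \<Rightarrow> 'v::ab_group_add \<Rightarrow> 'v" +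
  fixes \<pi> :: 'k and V :: "'v set"
  assumes uniformizer: "uniformizer ord \<pi>"
    and subspace_V: "subspace V"
begin

lemma pi_nz [simp]: "\<pi> \<noteq> 0" and ord_pi [simp]: "ord \<pi> = 1"
  using uniformizer by (auto simp: uniformizer_def)

lemma pi_in_O [simp]: "\<pi> \<in> \<O>"
  by (simp add: valuation_ring_def)

lemma maximal_ideal_iff: "x \<in> maximal_ideal ord \<longleftrightarrow> (\<exists>c\<in>\<O>. x = \<pi> * c)"
proof
  assume x: "x \<in> maximal_ideal ord"
  then have "x = 0 \<or> ord \<pi> \<le> ord x"
    by (auto simp: maximal_ideal_def)
  then have "x / \<pi> \<in> \<O>"
    using O_divide pi_nz by blast
  then show "\<exists>c\<in>\<O>. x = \<pi> * c"
    by (intro bexI[of _ "x / \<pi>"]) auto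
next
  assume "\<exists>c\<in>\<O>. x = \<pi> * c"
  then show "x \<in> maximal_ideal ord"
    using ord_mult[of \<pi>] by (fastforce simp: maximal_ideal_def valuation_ring_def)
qed

definition submod :: "'v set \<Rightarrow> bool" where
  "submod M \<longleftrightarrow> 0 \<in> M \<and> (\<forall>x\<in>M. \<forall>y\<in>M. x + y \<in> M) \<and> (\<forall>c\<in>\<O>. \<forall>x\<in>M. scale c x \<in> M)"

lemma submod_0: "submod M \<Longrightarrow> 0 \<in> M"
  and submod_add: "submod M \<Longrightarrow> x \<in> M \<Longrightarrow> y \<in> M \<Longrightarrow> x + y \<in> M"
  and submod_scale: "submod M \<Longrightarrow> c \<in> \<O> \<Longrightarrow> x \<in> M \<Longrightarrow> scale c x \<in> M"
  by (auto simp: submod_def)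

lemma submod_uminus: "submod M \<Longrightarrow> x \<in> M \<Longrightarrow> - x \<in> M"
  using submod_scale[of M "- 1" x] O_uminus[OF O_1] by simp

lemma submod_diff: "submod M \<Longrightarrow> x \<in> M \<Longrightarrow> y \<in> M \<Longrightarrow> x - y \<in> M"
  using submod_add[of M x "- y"] submod_uminus[of M y] by simp

lemma submod_add_iff: "submod M \<Longrightarrow> x \<in> M \<Longrightarrow> x + y \<in> M \<longleftrightarrow> y \<in> M"
  using submod_add[of M x y] submod_diff[of M "x + y" x] by auto

lemma submod_sum: "submod M \<Longrightarrow> (\<And>i. i \<in> I \<Longrightarrow> f i \<in> M) \<Longrightarrow> sum f I \<in> M"
  by (induction I rule: infinite_finite_induct) (auto intro: submod_0 submod_add)

lemma submod_Int: "submod M \<Longrightarrow> submod N \<Longrightarrow> submod (M \<inter> N)"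
  by (auto simp: submod_def)

lemma submod_dilate: "submod M \<Longrightarrow> submod (scale c ` M)"
  unfolding submod_def
  by (auto simp: image_iff scale_right_distrib[symmetric] scale_left_commute[of _ c]) force+

lemma dilate_dilate: "scale a ` scale b ` X = scale (a * b) ` X"
  by (simp add: image_image)

lemma dilate_1 [simp]: "scale 1 ` X = X"
  by simp

lemma dilate_mono_iff: "c \<noteq> 0 \<Longrightarrow> scale c ` X \<subseteq> scale c ` Y \<longleftrightarrow> X \<subseteq> Y"
  by (metis dilate_1 dilate_dilate image_mono left_inverse)

lemma dilate_eq_iff: "c \<noteq> 0 \<Longrightarrow> scale c ` X = scale c ` Y \<longleftrightarrow> X = Y"
  by (simp add: set_eq_subset dilate_mono_iff)

lemma dilate_psubset_iff: "c \<noteq> 0 \<Longrightarrow> scale c ` X \<subset> scale c ` Y \<longleftrightarrow> X \<subset> Y"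
  by (simp add: psubset_eq dilate_mono_iff dilate_eq_iff)

lemma dilate_subset:
  assumes "submod M" "a \<noteq> 0" "b \<noteq> 0" "ord b \<le> ord a"
  shows "scale a ` M \<subseteq> scale b ` M"
proof -
  have "a / b \<in> \<O>"
    using assms O_divide by blast
  then have "scale (a / b) ` M \<subseteq> M"
    using assms submod_scale by blast
  then have "scale b ` scale (a / b) ` M \<subseteq> scale b ` M"
    by blast
  then show ?thesis
    using assms by (simp add: dilate_dilate)
qed

lemma dilate_eq:
  "submod M \<Longrightarrow> a \<noteq> 0 \<Longrightarrow> b \<noteq> 0 \<Longrightarrow> ord a = ord b \<Longrightarrow> scale a ` M = scale b ` M"
  by (simp add: dilate_subset subset_antisym)

lemma pi_dilate_subset: "submod M \<Longrightarrow> scale \<pi> ` M \<subseteq> M"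
  using dilate_subset[of M \<pi> 1] by simp

definition adjoin :: "'v set \<Rightarrow> 'v \<Rightarrow> 'v set" where
  "adjoin A x = {a + scale c x | a c. a \<in> A \<and> c \<in> \<O>}"

lemma submod_adjoin:
  assumes "submod A"
  shows "submod (adjoin A x)"
  unfolding submod_def
proof (intro conjI ballI)
  show "0 \<in> adjoin A x"
    unfolding adjoin_def using submod_0[OF assms] by (intro CollectI exI[of _ 0]) simp
next
  fix u v assume "u \<in> adjoin A x" "v \<in> adjoin A x"
  then obtain a c a' c' where "a \<in> A" "c \<in> \<O>" "a' \<in> A" "c' \<in> \<O>"
    and "u = a + scale c x" "v = a' + scale c' x"
    by (auto simp: adjoin_def)
  then show "u + v \<in> adjoin A x"
    unfolding adjoin_def using submod_add[OF assms] O_add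
    by (intro CollectI exI[of _ "a + a'"] exI[of _ "c + c'"])
      (simp add: scale_left_distrib algebra_simps)
next
  fix e u assume "e \<in> \<O>" "u \<in> adjoin A x"
  then obtain a c where "a \<in> A" "c \<in> \<O>" "u = a + scale c x"
    by (auto simp: adjoin_def)
  then show "scale e u \<in> adjoin A x"
    unfolding adjoin_def using \<open>e \<in> \<O>\<close> submod_scale[OF assms] O_mult
    by (intro CollectI exI[of _ "scale e a"] exI[of _ "e * c"]) (simp add: scale_right_distrib)
qed

lemma adjoin_subset: "A \<subseteq> adjoin A x"
proof
  fix a assume "a \<in> A"
  then show "a \<in> adjoin A x"
    unfolding adjoin_def by (intro CollectI exI[of _ a] exI[of _ 0]) simp
qed

lemma mem_adjoin: "submod A \<Longrightarrow> x \<in> adjoin A x"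
  unfolding adjoin_def using submod_0 by (intro CollectI exI[of _ 0] exI[of _ 1]) simp

lemma adjoin_least: "submod M \<Longrightarrow> A \<subseteq> M \<Longrightarrow> x \<in> M \<Longrightarrow> adjoin A x \<subseteq> M"
  by (auto simp: adjoin_def intro!: submod_add submod_scale)


section \<open>The index of a submodule\<close>

definition coset :: "'v set \<Rightarrow> 'v \<Rightarrow> 'v set" where
  "coset A x = (+) x ` A"

definition index :: "'v set \<Rightarrow> 'v set \<Rightarrow> nat" where
  "index A B = card (coset A ` B)"

lemma mem_coset_iff: "y \<in> coset A x \<longleftrightarrow> y - x \<in> A"
  by (force simp: coset_def image_iff)

lemma coset_eq_iff:
  assumes "submod A"
  shows "coset A x = coset A y \<longleftrightarrow> x - y \<in> A"
proof
  assume "coset A x = coset A y"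
  then show "x - y \<in> A"
    using submod_0[OF assms] by (metis diff_self mem_coset_iff)
next
  assume xy: "x - y \<in> A"
  have "z - x \<in> A \<longleftrightarrow> z - y \<in> A" for z
    using submod_add_iff[OF assms xy, of "z - x"] by (simp add: algebra_simps)
  then show "coset A x = coset A y"
    by (simp add: set_eq_iff mem_coset_iff)
qed

text \<open>A choice \<open>r\<close> of representatives modulo \<open>X\<close> splits each coset of \<open>A\<close> uniquely as \<open>r Z + W\<close>,
  with \<open>Z\<close> a coset of \<open>X\<close> and \<open>W\<close> a coset of \<open>A\<close> inside \<open>X\<close>. Infinite indices are \<open>0\<close>, and the
  bijection covers them as well; a positive index thus records finiteness.\<close>

lemma index_mult:
  assumes A: "submod A" and X: "submod X" and B: "submod B" and "A \<subseteq> X" "X \<subseteq> B"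
  shows "index A B = index A X * index X B"
proof -
  define r where "r Z = (SOME b. b \<in> B \<and> coset X b = Z)" for Z
  have r: "r Z \<in> B \<and> coset X (r Z) = Z" if "Z \<in> coset X ` B" for Z
    unfolding r_def by (rule someI_ex) (use that in blast)
  have shift: "(+) b ` coset A w = coset A (b + w)" for b w
    by (auto simp: coset_def image_image add.assoc)
  let ?h = "\<lambda>(W, Z). (+) (r Z) ` W"
  have "inj_on ?h (coset A ` X \<times> coset X ` B)"
  proof (rule inj_onI, clarify)
    fix w z w' z'
    assume w: "w \<in> X" "w' \<in> X" and z: "z \<in> B" "z' \<in> B"
      and eq: "(+) (r (coset X z)) ` coset A w = (+) (r (coset X z')) ` coset A w'"
    let ?b = "r (coset X z)" and ?b' = "r (coset X z')"
    have A': "(?b + w) - (?b' + w') \<in> A"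
      using eq by (simp add: shift coset_eq_iff[OF A])
    then have "(w - w') + (?b - ?b') \<in> X"
      using \<open>A \<subseteq> X\<close> by (auto simp: algebra_simps)
    then have "?b - ?b' \<in> X"
      using submod_add_iff[OF X submod_diff[OF X w]] by simp
    then have Z: "coset X z = coset X z'"
      using r[of "coset X z"] r[of "coset X z'"] z coset_eq_iff[OF X] by (metis imageI)
    then show "coset A w = coset A w' \<and> coset X z = coset X z'"
      using A' by (simp add: coset_eq_iff[OF A])
  qed
  moreover have "?h ` (coset A ` X \<times> coset X ` B) = coset A ` B"
  proof (intro equalityI subsetI)
    fix W assume "W \<in> ?h ` (coset A ` X \<times> coset X ` B)"
    then obtain w z where "w \<in> X" "z \<in> B" "W = coset A (r (coset X z) + w)"
      by (auto simp: shift)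
    then show "W \<in> coset A ` B"
      using r[of "coset X z"] submod_add[OF B] \<open>X \<subseteq> B\<close> by blast
  next
    fix W assume "W \<in> coset A ` B"
    then obtain b where b: "b \<in> B" "W = coset A b"
      by blast
    define b' where "b' = r (coset X b)"
    have "b - b' \<in> X"
      using r[of "coset X b"] b coset_eq_iff[OF X, of b b'] unfolding b'_def by simp
    moreover have "?h (coset A (b - b'), coset X b) = W"
      using b by (simp add: shift b'_def)
    ultimately show "W \<in> ?h ` (coset A ` X \<times> coset X ` B)"
      using b by blast
  qed
  ultimately have "bij_betw ?h (coset A ` X \<times> coset X ` B) (coset A ` B)"
    by (simp add: bij_betw_def)
  then show ?thesis
    by (simp add: index_def bij_betw_same_card[symmetric] card_cartesian_product)
qed

lemma index_self: "submod A \<Longrightarrow> index A A = 1"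
proof -
  assume A: "submod A"
  have "coset A ` A = {coset A 0}"
    using submod_0[OF A] coset_eq_iff[OF A, of _ 0] by auto
  then show ?thesis by (simp add: index_def)
qed

lemma index_eq_1_iff:
  assumes "submod A" "A \<subseteq> B" "0 \<in> B"
  shows "index A B = 1 \<longleftrightarrow> A = B"
proof
  assume "index A B = 1"
  then obtain Z where "coset A ` B = {Z}"
    by (auto simp: index_def card_1_singleton_iff)
  then have "coset A b = coset A 0" if "b \<in> B" for b
    using that assms(3) by blast
  then show "A = B"
    using assms by (auto simp: coset_eq_iff)
qed (use assms index_self in simp)

lemma index_dilate:
  assumes "submod A" "c \<noteq> 0"
  shows "index (scale c ` A) (scale c ` B) = index A B"
proof -
  have "bij_betw (\<lambda>y. coset (scale c ` A) (scale c (inv_into B (coset A) y))) (coset A ` B)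
          ((\<lambda>b. coset (scale c ` A) (scale c b)) ` B)"
  proof (rule bij_betw_images_of_same_kernel)
    fix x y
    have "x - y \<in> A \<longleftrightarrow> scale c x - scale c y \<in> scale c ` A"
      using assms(2) by (auto simp: scale_right_diff_distrib[symmetric])
    then show "coset A x = coset A y \<longleftrightarrow>
        coset (scale c ` A) (scale c x) = coset (scale c ` A) (scale c y)"
      using assms(1) by (simp add: coset_eq_iff submod_dilate)
  qed
  then show ?thesis
    unfolding index_def by (simp add: image_image bij_betw_same_card)
qed

text \<open>Multiplying \<open>x\<close> by scalars identifies the residue field with the quotient, since a scalar
  carries \<open>x\<close> into \<open>A\<close> exactly if it is no unit.\<close>

lemma index_adjoin:
  assumes A: "submod A" and x: "x \<notin> A" "scale \<pi> x \<in> A"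
  shows "index A (adjoin A x) = q"
proof -
  have kernel: "scale c x \<in> A \<longleftrightarrow> c \<in> maximal_ideal ord" if "c \<in> \<O>" for c
  proof
    assume c: "scale c x \<in> A"
    show "c \<in> maximal_ideal ord"
    proof (rule ccontr)
      assume "c \<notin> maximal_ideal ord"
      then have "c \<noteq> 0" "inverse c \<in> \<O>"
        using unit_iff that by blast+
      then show False
        using submod_scale[OF A _ c, of "inverse c"] x(1) by simp
    qed
  next
    assume "c \<in> maximal_ideal ord"
    then obtain d where "d \<in> \<O>" "c = \<pi> * d"
      using maximal_ideal_iff by blast
    then show "scale c x \<in> A"
      using submod_scale[OF A _ x(2), of d] by (simp add: mult.commute)
  qed
  have "bij_betw (\<lambda>y. coset A (scale (inv_into \<O> (\<lambda>c. {d \<in> \<O>. c - d \<in> maximal_ideal ord}) y) x))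
          (residue_field ord) ((\<lambda>c. coset A (scale c x)) ` \<O>)"
    unfolding residue_field_eq_image
  proof (rule bij_betw_images_of_same_kernel)
    fix c d assume "c \<in> \<O>" "d \<in> \<O>"
    then show "{e \<in> \<O>. c - e \<in> maximal_ideal ord} = {e \<in> \<O>. d - e \<in> maximal_ideal ord} \<longleftrightarrow>
        coset A (scale c x) = coset A (scale d x)"
      using kernel[of "c - d"] O_diff
      by (simp only: residue_class_eq_iff coset_eq_iff[OF A] scale_left_diff_distrib)
  qed
  moreover have "(\<lambda>c. coset A (scale c x)) ` \<O> = coset A ` adjoin A x"
  proof (intro equalityI subsetI)
    fix W assume "W \<in> (\<lambda>c. coset A (scale c x)) ` \<O>"
    then show "W \<in> coset A ` adjoin A x"
      using submod_scale[OF submod_adjoin[OF A] _ mem_adjoin[OF A]] by blast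
  next
    fix W assume "W \<in> coset A ` adjoin A x"
    then obtain a c where ac: "a \<in> A" "c \<in> \<O>" and W: "W = coset A (a + scale c x)"
      by (auto simp: adjoin_def)
    have "W = coset A (scale c x)"
      unfolding W coset_eq_iff[OF A] using ac by simp
    then show "W \<in> (\<lambda>c. coset A (scale c x)) ` \<O>"
      using ac by blast
  qed
  ultimately show ?thesis
    by (simp add: index_def bij_betw_same_card)
qed

text \<open>The first step of a chain from \<open>A\<close> to \<open>B\<close>, by adjoining one element, contributes a factor
  \<open>q\<close>.\<close>

lemma q_dvd_index:
  assumes "submod A" "submod B" "A \<subset> B" "scale \<pi> ` B \<subseteq> A"
  shows "q dvd index A B"
proof -
  obtain x where x: "x \<in> B" "x \<notin> A"
    using assms(3) by blast
  have "index A B = index A (adjoin A x) * index (adjoin A x) B"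
    using assms x by (intro index_mult submod_adjoin adjoin_subset adjoin_least) auto
  moreover have "index A (adjoin A x) = q"
    using assms x by (intro index_adjoin) auto
  ultimately show ?thesis by simp
qed

definition covers :: "'v set \<Rightarrow> 'v set \<Rightarrow> bool" where
  "covers A B \<longleftrightarrow> submod A \<and> submod B \<and> A \<subset> B \<and>
     (\<forall>X. submod X \<longrightarrow> A \<subseteq> X \<longrightarrow> X \<subseteq> B \<longrightarrow> X = A \<or> X = B)"

lemma covers_eq: "covers A B \<Longrightarrow> submod X \<Longrightarrow> A \<subseteq> X \<Longrightarrow> X \<subseteq> B \<Longrightarrow> X = A \<or> X = B"
  by (auto simp: covers_def)

lemma covers_dilate:
  assumes "c \<noteq> 0" "covers A B"
  shows "covers (scale c ` A) (scale c ` B)"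
  unfolding covers_def
proof (intro conjI allI impI)
  fix X assume X: "submod X" "scale c ` A \<subseteq> X" "X \<subseteq> scale c ` B"
  let ?Y = "scale (inverse c) ` X"
  have c: "scale c ` ?Y = X"
    using assms(1) by (simp add: dilate_dilate)
  then have "A \<subseteq> ?Y" "?Y \<subseteq> B"
    using X assms(1) dilate_mono_iff by metis+
  then have "?Y = A \<or> ?Y = B"
    using assms(2) X(1) by (intro covers_eq submod_dilate)
  then show "X = scale c ` A \<or> X = scale c ` B"
    using c by metis
qed (use assms in \<open>auto simp: covers_def submod_dilate dilate_psubset_iff\<close>)

lemma adjoin_of_covers:
  assumes "covers A B" "x \<in> B" "x \<notin> A"
  shows "adjoin A x = B"
  using covers_eq[OF assms(1) submod_adjoin adjoin_subset adjoin_least] assms mem_adjoin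
  by (auto simp: covers_def)

text \<open>An intermediate module larger than \<open>A\<close> contains a multiple of \<open>x\<close> by a unit, hence \<open>x\<close>.\<close>

lemma covers_adjoin:
  assumes A: "submod A" and x: "x \<notin> A" "scale \<pi> x \<in> A"
  shows "covers A (adjoin A x)"
  unfolding covers_def
proof (intro conjI allI impI)
  show "A \<subset> adjoin A x"
    using adjoin_subset mem_adjoin[OF A] x by blast
  fix X assume X: "submod X" "A \<subseteq> X" "X \<subseteq> adjoin A x"
  show "X = A \<or> X = adjoin A x"
  proof (cases "X \<subseteq> A")
    case False
    then obtain y where "y \<in> X" "y \<notin> A" by blast
    moreover from this obtain a c where ac: "a \<in> A" "c \<in> \<O>" "y = a + scale c x"
      using X(3) by (auto simp: adjoin_def)
    ultimately have cx: "scale c x \<in> X" "scale c x \<notin> A"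
      using submod_add_iff[OF X(1), of a] submod_add_iff[OF A, of a] X(2) by auto
    have "c \<notin> maximal_ideal ord"
    proof
      assume "c \<in> maximal_ideal ord"
      then obtain d where "d \<in> \<O>" "c = \<pi> * d"
        using maximal_ideal_iff by blast
      then show False
        using submod_scale[OF A _ x(2), of d] cx(2) by (simp add: mult.commute)
    qed
    then have "c \<noteq> 0" "inverse c \<in> \<O>"
      using unit_iff ac by blast+
    then have "x \<in> X"
      using submod_scale[OF X(1) _ cx(1), of "inverse c"] by simp
    then show ?thesis
      using X adjoin_least by blast
  qed (use X in blast)
qed (use A submod_adjoin in auto)

lemma index_covers: "covers A B \<Longrightarrow> scale \<pi> ` B \<subseteq> A \<Longrightarrow> index A B = q"
proof -
  assume AB: "covers A B" and sub: "scale \<pi> ` B \<subseteq> A"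
  then obtain x where x: "x \<in> B" "x \<notin> A"
    by (auto simp: covers_def)
  then show "index A B = q"
    using index_adjoin[of A x] adjoin_of_covers[OF AB x] AB sub by (auto simp: covers_def)
qed

lemma covers_of_index:
  assumes "submod A" "submod B" "A \<subseteq> B" "scale \<pi> ` B \<subseteq> A" "index A B = q"
  shows "covers A B"
proof -
  have "A \<noteq> B"
    using assms(5) index_self[OF assms(1)] q_ge_2 by auto
  then obtain x where x: "x \<in> B" "x \<notin> A"
    using assms(3) by blast
  have "index A B = index A (adjoin A x) * index (adjoin A x) B"
    using assms x by (intro index_mult submod_adjoin adjoin_subset adjoin_least) auto
  moreover have "index A (adjoin A x) = q"
    using assms x by (intro index_adjoin) auto
  ultimately have "index (adjoin A x) B = 1"
    using q_ge_2 assms by simp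
  then have "adjoin A x = B"
    using index_eq_1_iff[of "adjoin A x" B] assms x submod_adjoin adjoin_least submod_0 by metis
  moreover have "covers A (adjoin A x)"
    using assms x by (intro covers_adjoin) auto
  ultimately show ?thesis by simp
qed

text \<open>Both indices are multiples of \<open>q\<close> with product \<open>q\<^sup>2\<close>.\<close>

lemma covers_of_index_square:
  assumes "submod A" "submod X" "submod B" "A \<subset> X" "X \<subset> B" "scale \<pi> ` B \<subseteq> A"
    and "index A B = q ^ 2"
  shows "covers A X" "covers X B"
proof -
  obtain a where a: "index A X = q * a"
    using q_dvd_index[of A X] assms by blast
  obtain b where b: "index X B = q * b"
    using q_dvd_index[of X B] assms by blast
  have "index A B = index A X * index X B"
    using assms by (intro index_mult) auto
  then have "q ^ 2 * (a * b) = q ^ 2 * 1"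
    using assms(7) a b by (simp add: power2_eq_square algebra_simps)
  then have "a = 1" "b = 1"
    using q_ge_2 by simp_all
  then show "covers A X" "covers X B"
    using assms a b by (auto intro!: covers_of_index)
qed

end


section \<open>Counting maximal chains of submodules\<close>

text \<open>The number of complete flags of a vector space of dimension \<open>d\<close> over a field with \<open>q\<close>
  elements: the quotient is the number of its lines.\<close>

fun flag_count :: "nat \<Rightarrow> nat \<Rightarrow> nat" where
  "flag_count q 0 = 1"
| "flag_count q (Suc d) = (q ^ Suc d - 1) div (q - 1) * flag_count q d"

lemma flag_count_pos:
  assumes "q \<ge> 2"
  shows "flag_count q d > 0"
proof (induction d)
  case (Suc d)
  have "q ^ 1 \<le> q ^ Suc d"
    using assms by (intro power_increasing) auto
  then have "(q ^ Suc d - 1) div (q - 1) > 0"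
    using assms by (simp add: div_greater_zero_iff del: power_Suc)
  then show ?case
    using Suc by simp
qed simp

lemma flag_count_1: "q \<ge> 2 \<Longrightarrow> flag_count q 1 = 1"
  by simp

context lattice_space
begin

definition interval :: "'v set \<Rightarrow> 'v set \<Rightarrow> 'v set set" where
  "interval A B = {X. submod X \<and> A \<subseteq> X \<and> X \<subseteq> B}"

text \<open>Maximality is phrased through comparability, so that a maximal chain automatically contains
  the end points whenever these are modules with \<open>A \<subseteq> B\<close>.\<close>

definition maxchains :: "'v set \<Rightarrow> 'v set \<Rightarrow> 'v set set set" where
  "maxchains A B = {E. E \<subseteq> interval A B \<and> (\<forall>X\<in>E. \<forall>Y\<in>E. X \<subseteq> Y \<or> Y \<subseteq> X) \<and>
     (\<forall>X\<in>interval A B. (\<forall>Y\<in>E. X \<subseteq> Y \<or> Y \<subseteq> X) \<longrightarrow> X \<in> E)}"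

definition atoms :: "'v set \<Rightarrow> 'v set \<Rightarrow> 'v set set" where
  "atoms A B = {X. covers A X \<and> X \<subseteq> B}"

text \<open>A module between \<open>A\<close> and \<open>B\<close> is determined by the cosets of \<open>A\<close> that it consists of.\<close>

lemma finite_interval:
  assumes "submod A" "index A B > 0"
  shows "finite (interval A B)"
proof (rule finite_imageD)
  have "finite (coset A ` B)"
    using assms(2) card_ge_0_finite by (auto simp: index_def)
  moreover have "(\<lambda>X. coset A ` X) ` interval A B \<subseteq> Pow (coset A ` B)"
    by (auto simp: interval_def)
  ultimately show "finite ((\<lambda>X. coset A ` X) ` interval A B)"
    using finite_subset by blast
  have "Y \<subseteq> X" if "X \<in> interval A B" and "coset A ` X = coset A ` Y" for X Y
  proof
    fix y assume "y \<in> Y"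
    then obtain x where "x \<in> X" "coset A y = coset A x"
      using \<open>coset A ` X = coset A ` Y\<close> by blast
    then have "x \<in> X" "y - x \<in> X"
      using coset_eq_iff[OF assms(1)] that(1) by (auto simp: interval_def)
    then show "y \<in> X"
      using that(1) submod_add[of X x "y - x"] by (simp add: interval_def)
  qed
  then show "inj_on (\<lambda>X. coset A ` X) (interval A B)"
    by (intro inj_onI subset_antisym) simp_all
qed

text \<open>The atoms partition the nonzero elements of \<open>B/A\<close>, as the lines through \<open>0\<close> do in a vector
  space, and each of them contains \<open>q - 1\<close>.\<close>

lemma card_atoms:
  assumes A: "submod A" and B: "submod B" and sub: "A \<subseteq> B" "scale \<pi> ` B \<subseteq> A"
    and fin: "index A B > 0"
  shows "finite (atoms A B)" "card (atoms A B) * (q - 1) + 1 = index A B"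
proof -
  have "atoms A B \<subseteq> interval A B"
    by (auto simp: atoms_def interval_def covers_def)
  then show fin_atoms: "finite (atoms A B)"
    using finite_interval[OF A fin] finite_subset by blast
  let ?c = "\<lambda>X. coset A ` X - {coset A 0}"
  have finB: "finite (coset A ` B)"
    using fin card_ge_0_finite by (auto simp: index_def)
  have nz: "coset A x \<noteq> coset A 0 \<longleftrightarrow> x \<notin> A" for x
    using coset_eq_iff[OF A, of x 0] by simp
  have union: "?c B = \<Union> (?c ` atoms A B)"
  proof (intro equalityI subsetI)
    fix W assume "W \<in> ?c B"
    then obtain x where x: "x \<in> B" "x \<notin> A" "W = coset A x"
      using nz by blast
    then have "adjoin A x \<in> atoms A B"
      using A B sub covers_adjoin adjoin_least by (auto simp: atoms_def)
    moreover have "W \<in> ?c (adjoin A x)"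
      using x mem_adjoin[OF A] nz by blast
    ultimately show "W \<in> \<Union> (?c ` atoms A B)"
      by blast
  next
    fix W assume "W \<in> \<Union> (?c ` atoms A B)"
    then show "W \<in> ?c B" by (auto simp: atoms_def)
  qed
  have card1: "card (?c X) = q - 1" if X: "X \<in> atoms A B" for X
  proof -
    have "scale \<pi> ` X \<subseteq> A"
      using X sub by (auto simp: atoms_def)
    then have "card (coset A ` X) = q"
      using index_covers[of A X] X by (simp add: atoms_def index_def)
    moreover have "coset A 0 \<in> coset A ` X"
      using X submod_0 by (auto simp: atoms_def covers_def)
    ultimately show ?thesis by (simp add: card_Diff_singleton)
  qed
  have disj: "?c X \<inter> ?c Y = {}" if XY: "X \<in> atoms A B" "Y \<in> atoms A B" "X \<noteq> Y" for X Y
  proof (rule ccontr)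
    assume "?c X \<inter> ?c Y \<noteq> {}"
    then obtain x y where xy: "x \<in> X" "y \<in> Y" "x \<notin> A" "coset A x = coset A y"
      using nz by blast
    have "A \<subseteq> Y" "submod Y"
      using XY by (auto simp: atoms_def covers_def)
    then have "x \<in> Y"
      using xy submod_add[of Y y "x - y"] coset_eq_iff[OF A, of x y] by auto
    then have "X = Y"
      using adjoin_of_covers[of A X x] adjoin_of_covers[of A Y x] XY xy by (simp add: atoms_def)
    then show False using XY by simp
  qed
  have "card (?c B) = (\<Sum>X\<in>atoms A B. card (?c X))"
    unfolding union
  proof (rule card_UN_disjoint[OF fin_atoms])
    show "\<forall>X\<in>atoms A B. finite (?c X)"
      using finB by (auto simp: atoms_def intro: finite_subset[OF image_mono])
    show "\<forall>X\<in>atoms A B. \<forall>Y\<in>atoms A B. X \<noteq> Y \<longrightarrow> ?c X \<inter> ?c Y = {}"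
      using disj by blast
  qed
  also have "\<dots> = card (atoms A B) * (q - 1)"
    using card1 by simp
  finally have "card (?c B) = card (atoms A B) * (q - 1)" .
  moreover have "coset A 0 \<in> coset A ` B"
    using submod_0[OF B] by blast
  then have "card (?c B) + 1 = index A B"
    using fin finB by (simp add: index_def card_Diff_singleton)
  ultimately show "card (atoms A B) * (q - 1) + 1 = index A B" by simp
qed

lemma maxchainsI:
  assumes "E \<subseteq> interval A B" "\<And>X Y. X \<in> E \<Longrightarrow> Y \<in> E \<Longrightarrow> X \<subseteq> Y \<or> Y \<subseteq> X"
    and "\<And>X. X \<in> interval A B \<Longrightarrow> (\<And>Y. Y \<in> E \<Longrightarrow> X \<subseteq> Y \<or> Y \<subseteq> X) \<Longrightarrow> X \<in> E"
  shows "E \<in> maxchains A B"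
  using assms by (auto simp: maxchains_def)

lemma maxchainsD:
  assumes "E \<in> maxchains A B"
  shows "X \<in> E \<Longrightarrow> submod X" "X \<in> E \<Longrightarrow> A \<subseteq> X" "X \<in> E \<Longrightarrow> X \<subseteq> B"
    and "X \<in> E \<Longrightarrow> Y \<in> E \<Longrightarrow> X \<subseteq> Y \<or> Y \<subseteq> X"
  using assms by (auto simp: maxchains_def interval_def)

lemma maxchains_maximal:
  assumes "E \<in> maxchains A B" "submod X" "A \<subseteq> X" "X \<subseteq> B"
    and "\<And>Y. Y \<in> E \<Longrightarrow> X \<subseteq> Y \<or> Y \<subseteq> X"
  shows "X \<in> E"
  using assms by (auto simp: maxchains_def interval_def)

lemma bot_in_maxchain: "E \<in> maxchains A B \<Longrightarrow> submod A \<Longrightarrow> A \<subseteq> B \<Longrightarrow> A \<in> E"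
  by (rule maxchains_maximal) (auto dest: maxchainsD)

lemma top_in_maxchain: "E \<in> maxchains A B \<Longrightarrow> submod B \<Longrightarrow> A \<subseteq> B \<Longrightarrow> B \<in> E"
  by (rule maxchains_maximal) (auto dest: maxchainsD)

lemma maxchain_insert_bot:
  assumes cov: "covers A X" and "X \<subseteq> B" and E: "E \<in> maxchains X B"
  shows "insert A E \<in> maxchains A B"
proof (rule maxchainsI)
  have X: "submod A" "submod X" "A \<subset> X"
    using cov by (auto simp: covers_def)
  show "insert A E \<subseteq> interval A B"
    unfolding interval_def using X maxchainsD(1,2,3)[OF E] \<open>X \<subseteq> B\<close> by blast
  show "Y \<subseteq> Z \<or> Z \<subseteq> Y" if "Y \<in> insert A E" "Z \<in> insert A E" for Y Z
    using that X maxchainsD(2,3,4)[OF E] by blast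
  show "Z \<in> insert A E" if Z: "Z \<in> interval A B"
    and comp: "\<And>Y. Y \<in> insert A E \<Longrightarrow> Z \<subseteq> Y \<or> Y \<subseteq> Z" for Z
  proof -
    have "X \<in> E"
      using E X \<open>X \<subseteq> B\<close> bot_in_maxchain by blast
    then consider "Z \<subseteq> X" | "X \<subseteq> Z"
      using comp by blast
    then show ?thesis
    proof cases
      case 1
      then show ?thesis
        using covers_eq[OF cov, of Z] Z \<open>X \<in> E\<close> by (auto simp: interval_def)
    next
      case 2
      then show ?thesis
        using maxchains_maximal[OF E, of Z] Z comp by (auto simp: interval_def)
    qed
  qed
qed

lemma maxchain_insert_top:
  assumes cov: "covers X B" and "A \<subseteq> X" and E: "E \<in> maxchains A X"
  shows "insert B E \<in> maxchains A B"
proof (rule maxchainsI)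
  have X: "submod B" "submod X" "X \<subset> B"
    using cov by (auto simp: covers_def)
  show "insert B E \<subseteq> interval A B"
    unfolding interval_def using X maxchainsD(1,2,3)[OF E] \<open>A \<subseteq> X\<close> by blast
  show "Y \<subseteq> Z \<or> Z \<subseteq> Y" if "Y \<in> insert B E" "Z \<in> insert B E" for Y Z
    using that X maxchainsD(2,3,4)[OF E] by blast
  show "Z \<in> insert B E" if Z: "Z \<in> interval A B"
    and comp: "\<And>Y. Y \<in> insert B E \<Longrightarrow> Z \<subseteq> Y \<or> Y \<subseteq> Z" for Z
  proof -
    have "X \<in> E"
      using E X \<open>A \<subseteq> X\<close> top_in_maxchain by blast
    then consider "Z \<subseteq> X" | "X \<subseteq> Z"
      using comp by blast
    then show ?thesis
    proof cases
      case 1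
      then show ?thesis
        using maxchains_maximal[OF E, of Z] Z comp by (auto simp: interval_def)
    next
      case 2
      then show ?thesis
        using covers_eq[OF cov, of Z] Z \<open>X \<in> E\<close> by (auto simp: interval_def)
    qed
  qed
qed

text \<open>The least member above \<open>A\<close> covers \<open>A\<close>: a module in between would be comparable with the
  whole chain.\<close>

lemma maxchain_remove_bot:
  assumes A: "submod A" and B: "submod B" and AB: "A \<subset> B" and E: "E \<in> maxchains A B"
    and fin: "finite E"
  obtains X D where "covers A X" "X \<subseteq> B" "D \<in> maxchains X B" "E = insert A D"
proof -
  have "B \<in> E - {A}"
    using top_in_maxchain[OF E B] AB by blast
  then obtain X where X: "X \<in> E" "X \<noteq> A" and min: "\<And>Y. Y \<in> E - {A} \<Longrightarrow> Y \<subseteq> X \<Longrightarrow> X = Y"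
    using finite_has_minimal[of "E - {A}"] fin by (metis DiffE empty_iff finite_Diff insertI1)
  have least: "X \<subseteq> Y" if "Y \<in> E" "Y \<noteq> A" for Y
    using min[of Y] maxchainsD(4)[OF E X(1) that(1)] that by blast
  have AX: "A \<subset> X" "submod X" "X \<subseteq> B"
    using maxchainsD[OF E X(1)] X by auto
  show ?thesis
  proof
    show "E = insert A (E - {A})"
      using bot_in_maxchain[OF E A] AB by blast
    show "covers A X"
      unfolding covers_def
    proof (intro conjI allI impI)
      fix Z assume Z: "submod Z" "A \<subseteq> Z" "Z \<subseteq> X"
      have "Z \<in> E"
      proof (rule maxchains_maximal[OF E Z(1,2)])
        show "Z \<subseteq> Y \<or> Y \<subseteq> Z" if "Y \<in> E" for Y
          using least[OF that] Z by blast
      qed (use Z AX in blast)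
      then show "Z = A \<or> Z = X"
        using least[of Z] Z by blast
    qed (use A AX in auto)
    show "E - {A} \<in> maxchains X B"
    proof (rule maxchainsI)
      show "E - {A} \<subseteq> interval X B"
        unfolding interval_def using maxchainsD(1,3)[OF E] least by blast
      show "Y \<subseteq> Z \<or> Z \<subseteq> Y" if "Y \<in> E - {A}" "Z \<in> E - {A}" for Y Z
        using that maxchainsD(4)[OF E] by blast
      show "Z \<in> E - {A}" if Z: "Z \<in> interval X B"
        and "\<And>Y. Y \<in> E - {A} \<Longrightarrow> Z \<subseteq> Y \<or> Y \<subseteq> Z" for Z
      proof -
        have "submod Z" "A \<subset> Z" "Z \<subseteq> B"
          using Z AX by (auto simp: interval_def)
        with that(2) show ?thesis
          using maxchains_maximal[OF E, of Z] by blast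
      qed
    qed
  qed (use AX in auto)
qed

lemma maxchain_remove_top:
  assumes A: "submod A" and B: "submod B" and AB: "A \<subset> B" and E: "E \<in> maxchains A B"
    and fin: "finite E"
  obtains X D where "covers X B" "A \<subseteq> X" "D \<in> maxchains A X" "E = insert B D"
proof -
  have "A \<in> E - {B}"
    using bot_in_maxchain[OF E A] AB by blast
  then obtain X where X: "X \<in> E" "X \<noteq> B" and max: "\<And>Y. Y \<in> E - {B} \<Longrightarrow> X \<subseteq> Y \<Longrightarrow> X = Y"
    using finite_has_maximal[of "E - {B}"] fin by (metis DiffE empty_iff finite_Diff insertI1)
  have greatest: "Y \<subseteq> X" if "Y \<in> E" "Y \<noteq> B" for Y
    using max[of Y] maxchainsD(4)[OF E X(1) that(1)] that by blast
  have XB: "X \<subset> B" "submod X" "A \<subseteq> X"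
    using maxchainsD[OF E X(1)] X by auto
  show ?thesis
  proof
    show "E = insert B (E - {B})"
      using top_in_maxchain[OF E B] AB by blast
    show "covers X B"
      unfolding covers_def
    proof (intro conjI allI impI)
      fix Z assume Z: "submod Z" "X \<subseteq> Z" "Z \<subseteq> B"
      have "Z \<in> E"
      proof (rule maxchains_maximal[OF E Z(1) _ Z(3)])
        show "Z \<subseteq> Y \<or> Y \<subseteq> Z" if "Y \<in> E" for Y
          using greatest[OF that] Z by blast
      qed (use Z XB in blast)
      then show "Z = X \<or> Z = B"
        using greatest[of Z] Z by blast
    qed (use B XB in auto)
    show "E - {B} \<in> maxchains A X"
    proof (rule maxchainsI)
      show "E - {B} \<subseteq> interval A X"
        unfolding interval_def using maxchainsD(1,2)[OF E] greatest by blast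
      show "Y \<subseteq> Z \<or> Z \<subseteq> Y" if "Y \<in> E - {B}" "Z \<in> E - {B}" for Y Z
        using that maxchainsD(4)[OF E] by blast
      show "Z \<in> E - {B}" if Z: "Z \<in> interval A X"
        and "\<And>Y. Y \<in> E - {B} \<Longrightarrow> Z \<subseteq> Y \<or> Y \<subseteq> Z" for Z
      proof -
        have "submod Z" "A \<subseteq> Z" "Z \<subset> B"
          using Z XB by (auto simp: interval_def)
        with that(2) show ?thesis
          using maxchains_maximal[OF E, of Z] by blast
      qed
    qed
  qed (use XB in auto)
qed

lemma finite_maxchain:
  assumes "submod A" "index A B > 0" "E \<in> maxchains A B"
  shows "finite E"
  using finite_interval[OF assms(1,2)] assms(3) finite_subset by (auto simp: maxchains_def)

lemma maxchains_decompose: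
  assumes "submod A" "submod B" "A \<subset> B" "index A B > 0"
  shows "maxchains A B = (\<Union>X\<in>atoms A B. insert A ` maxchains X B)"
proof (intro equalityI subsetI)
  fix E assume E: "E \<in> maxchains A B"
  obtain X D where "covers A X" "X \<subseteq> B" "D \<in> maxchains X B" "E = insert A D"
    using maxchain_remove_bot[OF assms(1-3) E finite_maxchain[OF assms(1,4) E]] by metis
  then show "E \<in> (\<Union>X\<in>atoms A B. insert A ` maxchains X B)"
    by (auto simp: atoms_def)
next
  fix E assume "E \<in> (\<Union>X\<in>atoms A B. insert A ` maxchains X B)"
  then obtain X D where "covers A X" "X \<subseteq> B" "D \<in> maxchains X B" "E = insert A D"
    unfolding atoms_def by blast
  then show "E \<in> maxchains A B"
    using maxchain_insert_bot[of A X B D] by simp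
qed

text \<open>A maximal chain amounts to the choice of an atom \<open>X\<close> and of a maximal chain from \<open>X\<close> to
  \<open>B\<close>; passing to \<open>X\<close> divides the index by \<open>q\<close>.\<close>

theorem card_maxchains:
  assumes "submod A" "submod B" "A \<subseteq> B" "scale \<pi> ` B \<subseteq> A" "index A B = q ^ d"
  shows "finite (maxchains A B) \<and> card (maxchains A B) = flag_count q d"
  using assms
proof (induction d arbitrary: A)
  case 0
  then have "A = B"
    using index_eq_1_iff submod_0 by simp
  then have "interval A B = {B}"
    using 0 by (auto simp: interval_def)
  then have "maxchains A B = {{B}}"
    unfolding maxchains_def by auto
  then show ?case by simp
next
  case (Suc d)
  have pos: "index A B > 0"
    using q_ge_2 by (simp add: Suc.prems(5))
  have "A \<noteq> B"
  proof
    assume "A = B"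
    then have "q ^ Suc d = 1"
      using Suc.prems index_self by simp
    then show False using q_ge_2 by simp
  qed
  then have AB: "A \<subset> B"
    using Suc.prems by blast
  have atom: "finite (maxchains X B) \<and> card (maxchains X B) = flag_count q d \<and> submod X \<and> X \<subseteq> B"
    if X: "X \<in> atoms A B" for X
  proof -
    have X': "submod X" "A \<subset> X" "X \<subseteq> B" "covers A X"
      using X by (auto simp: atoms_def covers_def)
    have "index A X = q"
      using X' Suc.prems by (intro index_covers) auto
    moreover have "index A B = index A X * index X B"
      using X' Suc.prems by (intro index_mult) auto
    ultimately have "index X B = q ^ d"
      using Suc.prems(5) q_ge_2 by simp
    then show ?thesis
      using X' Suc.prems
      by (intro conjI) (auto intro!: Suc.IH[THEN conjunct1] Suc.IH[THEN conjunct2])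
  qed
  have inj: "inj_on (insert A) (maxchains X B)" if X: "X \<in> atoms A B" for X
  proof (rule inj_onI)
    fix E D assume ED: "E \<in> maxchains X B" "D \<in> maxchains X B" and eq: "insert A E = insert A D"
    have "A \<notin> E" "A \<notin> D"
      using X maxchainsD(2)[OF ED(1), of A] maxchainsD(2)[OF ED(2), of A]
      by (auto simp: atoms_def covers_def)
    then show "E = D"
      using eq by (meson insert_ident)
  qed
  have disj: "insert A ` maxchains X B \<inter> insert A ` maxchains Y B = {}"
    if XY: "X \<in> atoms A B" "Y \<in> atoms A B" "X \<noteq> Y" for X Y
  proof (rule ccontr)
    assume "insert A ` maxchains X B \<inter> insert A ` maxchains Y B \<noteq> {}"
    then obtain E D where ED: "E \<in> maxchains X B" "D \<in> maxchains Y B" "insert A E = insert A D"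
      by blast
    have "X \<in> E" "Y \<in> D"
      using ED XY bot_in_maxchain by (auto simp: atoms_def covers_def)
    moreover have "X \<noteq> A" "Y \<noteq> A"
      using XY by (auto simp: atoms_def covers_def)
    ultimately have "X \<in> D" "Y \<in> E"
      using ED(3) by blast+
    then show False
      using XY(3) maxchainsD(2)[OF ED(1) \<open>Y \<in> E\<close>] maxchainsD(2)[OF ED(2) \<open>X \<in> D\<close>] by blast
  qed
  note fin_atoms = card_atoms[OF Suc.prems(1-4) pos]
  have "finite (maxchains A B)"
    unfolding maxchains_decompose[OF Suc.prems(1,2) AB pos] using fin_atoms(1) atom by blast
  moreover have "card (maxchains A B) = (\<Sum>X\<in>atoms A B. card (insert A ` maxchains X B))"
    unfolding maxchains_decompose[OF Suc.prems(1,2) AB pos]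
  proof (rule card_UN_disjoint[OF fin_atoms(1)])
    show "\<forall>X\<in>atoms A B. finite (insert A ` maxchains X B)"
      using atom by simp
    show "\<forall>X\<in>atoms A B. \<forall>Y\<in>atoms A B. X \<noteq> Y \<longrightarrow>
        insert A ` maxchains X B \<inter> insert A ` maxchains Y B = {}"
      by (intro ballI impI disj)
  qed
  moreover have "\<dots> = card (atoms A B) * flag_count q d"
    using atom inj by (simp add: card_image)
  moreover have "card (atoms A B) = (q ^ Suc d - 1) div (q - 1)"
  proof -
    have "q ^ Suc d - 1 = card (atoms A B) * (q - 1)"
      using fin_atoms(2) Suc.prems(5) by simp
    then show ?thesis
      using q_ge_2 by simp
  qed
  ultimately show ?case by simp
qed


section \<open>Lattices\<close>

abbreviation lattice :: "'v set \<Rightarrow> bool" where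
  "lattice L \<equiv> is_lattice ord scale V L"

definition O_span :: "'v set \<Rightarrow> 'v set" where
  "O_span B = {\<Sum>b\<in>B. scale (a b) b | a. a ` B \<subseteq> \<O>}"

definition O_indep :: "'v set \<Rightarrow> bool" where
  "O_indep B \<longleftrightarrow>
     (\<forall>a. a ` B \<subseteq> \<O> \<longrightarrow> (\<Sum>b\<in>B. scale (a b) b) = 0 \<longrightarrow> (\<forall>b\<in>B. a b = 0))"

lemma lattice_iff:
  "lattice L \<longleftrightarrow> (\<exists>B. finite B \<and> B \<subseteq> V \<and> card B = dim V \<and> O_indep B \<and> L = O_span B)"
  unfolding is_lattice_def O_span_def O_indep_def ..

lemma O_spanI: "a ` B \<subseteq> \<O> \<Longrightarrow> (\<Sum>b\<in>B. scale (a b) b) \<in> O_span B"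
  by (auto simp: O_span_def)

lemma submod_O_span: "submod (O_span B)"
  unfolding submod_def
proof (intro conjI ballI)
  show "0 \<in> O_span B"
    using O_spanI[of "\<lambda>_. 0" B] by (simp add: image_subset_iff)
next
  fix x y assume "x \<in> O_span B" "y \<in> O_span B"
  then obtain a a' where "a ` B \<subseteq> \<O>" "a' ` B \<subseteq> \<O>"
    and "x = (\<Sum>b\<in>B. scale (a b) b)" "y = (\<Sum>b\<in>B. scale (a' b) b)"
    by (auto simp: O_span_def)
  then show "x + y \<in> O_span B"
    using O_spanI[of "\<lambda>b. a b + a' b" B] O_add
    by (auto simp: scale_left_distrib sum.distrib image_subset_iff)
next
  fix c x assume "c \<in> \<O>" "x \<in> O_span B"
  then obtain a where "a ` B \<subseteq> \<O>" "x = (\<Sum>b\<in>B. scale (a b) b)"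
    by (auto simp: O_span_def)
  then show "scale c x \<in> O_span B"
    using O_spanI[of "\<lambda>b. c * a b" B] O_mult \<open>c \<in> \<O>\<close>
    by (auto simp: scale_sum_right image_subset_iff)
qed

lemma subset_O_span: "finite B \<Longrightarrow> B \<subseteq> O_span B"
proof
  fix b assume "finite B" "b \<in> B"
  then have "(\<Sum>b'\<in>B. scale (if b' = b then 1 else 0) b') = b"
    by (simp add: if_distrib[of "\<lambda>c. scale c _"] cong: if_cong)
  moreover have "(\<Sum>b'\<in>B. scale (if b' = b then 1 else 0) b') \<in> O_span B"
    by (rule O_spanI) auto
  ultimately show "b \<in> O_span B" by simp
qed

lemma O_span_least: "submod M \<Longrightarrow> B \<subseteq> M \<Longrightarrow> O_span B \<subseteq> M"
  by (auto simp: O_span_def intro!: submod_sum submod_scale)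

lemma O_indep_unique:
  assumes "O_indep B" "a ` B \<subseteq> \<O>" "a' ` B \<subseteq> \<O>"
    and "(\<Sum>b\<in>B. scale (a b) b) = (\<Sum>b\<in>B. scale (a' b) b)" "b \<in> B"
  shows "a b = a' b"
proof -
  have "(\<Sum>b\<in>B. scale (a b - a' b) b) = 0"
    using assms(4) by (simp add: scale_left_diff_distrib sum_subtractf)
  moreover have "(\<lambda>b. a b - a' b) ` B \<subseteq> \<O>"
    using assms(2,3) O_diff by blast
  ultimately have "a b - a' b = 0"
    using assms(1,5) unfolding O_indep_def by blast
  then show ?thesis by simp
qed

lemma submod_lattice: "lattice L \<Longrightarrow> submod L"
  by (auto simp: lattice_iff submod_O_span)

lemma lattice_subset_V: "lattice L \<Longrightarrow> L \<subseteq> V"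
  by (auto simp: lattice_iff O_span_def
      intro!: subspace_sum[OF subspace_V] subspace_scale[OF subspace_V])

lemma O_span_dilate:
  assumes "finite B" "c \<noteq> 0"
  shows "O_span (scale c ` B) = scale c ` O_span B"
proof
  show "O_span (scale c ` B) \<subseteq> scale c ` O_span B"
    using subset_O_span[OF assms(1)] by (intro O_span_least submod_dilate submod_O_span) blast
  have "scale (inverse c) ` scale c ` B \<subseteq> scale (inverse c) ` O_span (scale c ` B)"
    using subset_O_span[of "scale c ` B"] assms(1) by (intro image_mono) simp
  then have "O_span B \<subseteq> scale (inverse c) ` O_span (scale c ` B)"
    using assms(2) by (intro O_span_least submod_dilate submod_O_span) (simp add: dilate_dilate)
  then have "scale c ` O_span B \<subseteq> scale c ` scale (inverse c) ` O_span (scale c ` B)"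
    by (rule image_mono)
  then show "scale c ` O_span B \<subseteq> O_span (scale c ` B)"
    using assms(2) by (simp add: dilate_dilate)
qed

lemma lattice_dilate:
  assumes "lattice L" "c \<noteq> 0"
  shows "lattice (scale c ` L)"
proof -
  obtain B where B: "finite B" "B \<subseteq> V" "card B = dim V" "O_indep B" "L = O_span B"
    using assms(1) lattice_iff by auto
  have inj: "inj_on (scale c) B"
    using assms(2) by (simp add: inj_on_def)
  have "O_indep (scale c ` B)"
    unfolding O_indep_def
  proof (intro allI impI ballI)
    fix a b assume a: "a ` scale c ` B \<subseteq> \<O>" "(\<Sum>b\<in>scale c ` B. scale (a b) b) = 0"
      and "b \<in> scale c ` B"
    have "scale c (\<Sum>b\<in>B. scale (a (scale c b)) b) = 0"
      using a(2) by (simp add: sum.reindex[OF inj] scale_sum_right mult.commute)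
    then have "(\<Sum>b\<in>B. scale (a (scale c b)) b) = 0"
      using assms(2) by simp
    moreover have "(\<lambda>b. a (scale c b)) ` B \<subseteq> \<O>"
      using a(1) by auto
    ultimately have "\<forall>b\<in>B. a (scale c b) = 0"
      using B(4) unfolding O_indep_def by (elim allE[of _ "\<lambda>b. a (scale c b)"]) simp
    then show "a b = 0"
      using \<open>b \<in> scale c ` B\<close> by auto
  qed
  moreover have "scale c ` B \<subseteq> V"
    using B(2) subspace_scale[OF subspace_V] by blast
  ultimately show ?thesis
    unfolding lattice_iff using B card_image[OF inj] O_span_dilate[OF B(1) assms(2)]
    by (intro exI[of _ "scale c ` B"]) auto
qed

text \<open>Starting from \<open>\<pi>L\<close>, adjoin the members of a basis one after the other. Each step multiplies
  the index by \<open>q\<close>, because the next basis element has coefficient \<open>1\<close>, whereas in the module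
  built so far its coefficient always lies in the maximal ideal.\<close>

lemma index_pi_lattice:
  assumes "lattice L"
  shows "index (scale \<pi> ` L) L = q ^ dim V"
proof -
  obtain B where B: "finite B" "B \<subseteq> V" "card B = dim V" "O_indep B" "L = O_span B"
    using assms lattice_iff by auto
  let ?M = "scale \<pi> ` L"
  have L: "submod L" "B \<subseteq> L"
    using B submod_O_span subset_O_span by auto
  \<comment> \<open>The stage reached after the basis elements in \<open>S\<close>. Coefficients outside \<open>S\<close> stay in the
    maximal ideal; that keeps the next basis element out.\<close>
  have key: "\<exists>A. submod A \<and> ?M \<subseteq> A \<and> A \<subseteq> L \<and> S \<subseteq> A \<and> index ?M A = q ^ card S \<and>
     (\<forall>x\<in>A. \<exists>a. a ` B \<subseteq> \<O> \<and> (\<forall>b\<in>B - S. a b \<in> maximal_ideal ord) \<and> x = (\<Sum>b\<in>B. scale (a b) b))"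
    if "S \<subseteq> B" for S
    using finite_subset[OF that B(1)] that
  proof (induction S rule: finite_induct)
    case empty
    show ?case
    proof (intro exI[of _ ?M] conjI ballI)
      fix x assume "x \<in> ?M"
      then obtain a where a: "a ` B \<subseteq> \<O>" "x = scale \<pi> (\<Sum>b\<in>B. scale (a b) b)"
        using B(5) by (auto simp: O_span_def)
      show "\<exists>a. a ` B \<subseteq> \<O> \<and> (\<forall>b\<in>B - {}. a b \<in> maximal_ideal ord) \<and> x = (\<Sum>b\<in>B. scale (a b) b)"
        using a O_mult by (intro exI[of _ "\<lambda>b. \<pi> * a b"])
          (auto simp: scale_sum_right maximal_ideal_iff image_subset_iff)
    qed (use L pi_dilate_subset submod_dilate index_self in auto)
  next
    case (insert s S)
    then obtain A where A: "submod A" "?M \<subseteq> A" "A \<subseteq> L" "S \<subseteq> A" "index ?M A = q ^ card S"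
      and coeff: "\<And>x. x \<in> A \<Longrightarrow>
        \<exists>a. a ` B \<subseteq> \<O> \<and> (\<forall>b\<in>B - S. a b \<in> maximal_ideal ord) \<and> x = (\<Sum>b\<in>B. scale (a b) b)"
      by auto
    have s: "s \<in> B" "s \<notin> S" "s \<in> L"
      using insert L by auto
    have "s \<notin> A"
    proof
      assume "s \<in> A"
      then obtain a where a: "a ` B \<subseteq> \<O>" "a s \<in> maximal_ideal ord" "s = (\<Sum>b\<in>B. scale (a b) b)"
        using coeff s by blast
      have "s = (\<Sum>b\<in>B. scale (if b = s then 1 else 0) b)"
        using s(1) B(1) by (simp add: if_distrib[of "\<lambda>c. scale c _"] cong: if_cong)
      then have "(\<Sum>b\<in>B. scale (a b) b) = (\<Sum>b\<in>B. scale (if b = s then 1 else 0) b)"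
        using a(3) by simp
      then have "a s = 1"
        using O_indep_unique[OF B(4) a(1), of "\<lambda>b. if b = s then 1 else 0" s] s(1)
        by (simp add: image_subset_iff)
      then show False
        using a(2) by (simp add: maximal_ideal_def)
    qed
    moreover have "scale \<pi> s \<in> A"
      using A(2) s by blast
    ultimately have "index A (adjoin A s) = q"
      by (intro index_adjoin A(1))
    moreover have "index ?M (adjoin A s) = index ?M A * index A (adjoin A s)"
      using A L submod_dilate submod_adjoin adjoin_subset by (intro index_mult) auto
    ultimately have index: "index ?M (adjoin A s) = q ^ card (insert s S)"
      using A(5) insert by simp
    show ?case
    proof (intro exI[of _ "adjoin A s"] conjI ballI)
      show "insert s S \<subseteq> adjoin A s"
        using A(4) mem_adjoin[OF A(1)] adjoin_subset by blast
      show "adjoin A s \<subseteq> L"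
        using A(3) L s(3) adjoin_least by blast
      show "?M \<subseteq> adjoin A s"
        using A(2) adjoin_subset[of A s] by (rule subset_trans)
      fix x assume "x \<in> adjoin A s"
      then obtain y c where y: "y \<in> A" "c \<in> \<O>" "x = y + scale c s"
        by (auto simp: adjoin_def)
      obtain a where a: "a ` B \<subseteq> \<O>" "\<forall>b\<in>B - S. a b \<in> maximal_ideal ord"
          "y = (\<Sum>b\<in>B. scale (a b) b)"
        using coeff[OF y(1)] by blast
      let ?a = "\<lambda>b. a b + (if b = s then c else 0)"
      have "(\<Sum>b\<in>B. scale (?a b) b) = y + (\<Sum>b\<in>B. scale (if b = s then c else 0) b)"
        using a(3) by (simp only: scale_left_distrib sum.distrib)
      also have "(\<Sum>b\<in>B. scale (if b = s then c else 0) b) = scale c s"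
        using s(1) B(1) by (simp add: if_distrib[of "\<lambda>c. scale c _"] cong: if_cong)
      finally have "x = (\<Sum>b\<in>B. scale (?a b) b)"
        using y(3) by simp
      moreover have "?a ` B \<subseteq> \<O>"
        using a(1) y(2) O_add by auto
      moreover have "\<forall>b\<in>B - insert s S. ?a b \<in> maximal_ideal ord"
        using a(2) by auto
      ultimately show "\<exists>a. a ` B \<subseteq> \<O> \<and> (\<forall>b\<in>B - insert s S. a b \<in> maximal_ideal ord) \<and>
          x = (\<Sum>b\<in>B. scale (a b) b)"
        by blast
    qed (use index submod_adjoin[OF A(1)] in simp_all)
  qed
  obtain A where A: "submod A" "A \<subseteq> L" "B \<subseteq> A" "index ?M A = q ^ card B"
    using key[OF subset_refl] by (elim exE conjE)
  have "A = L"
    using O_span_least[OF A(1,3)] A(2) B(5) by blast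
  then show ?thesis
    using A(4) B(3) by simp
qed

text \<open>Exchange: as \<open>x\<close> is not in \<open>A\<close>, some coefficient of \<open>\<pi>x\<close> is a unit, and the corresponding
  basis element can be traded for \<open>x\<close>.\<close>

lemma lattice_adjoin:
  assumes "lattice A" and x: "x \<in> V" "x \<notin> A" "scale \<pi> x \<in> A"
  shows "lattice (adjoin A x)"
proof -
  obtain B where B: "finite B" "B \<subseteq> V" "card B = dim V" "O_indep B" "A = O_span B"
    using assms(1) lattice_iff by auto
  have A: "submod A" "B \<subseteq> A"
    using B submod_O_span subset_O_span by auto
  obtain c where c: "c ` B \<subseteq> \<O>" "scale \<pi> x = (\<Sum>b\<in>B. scale (c b) b)"
    using x(3) B(5) by (auto simp: O_span_def)
  obtain u where u: "u \<in> B" "c u \<notin> maximal_ideal ord"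
  proof (rule ccontr)
    assume "\<not> thesis"
    then have "\<forall>b\<in>B. \<exists>d\<in>\<O>. c b = \<pi> * d"
      using maximal_ideal_iff that by blast
    then obtain d where d: "\<And>b. b \<in> B \<Longrightarrow> d b \<in> \<O> \<and> c b = \<pi> * d b"
      by metis
    have "scale \<pi> x = scale \<pi> (\<Sum>b\<in>B. scale (d b) b)"
      unfolding c(2) using d by (simp add: scale_sum_right)
    then have "x = (\<Sum>b\<in>B. scale (d b) b)"
      by simp
    then show False
      using x(2) B(5) d O_spanI[of d B] by auto
  qed
  have cu: "c u \<noteq> 0" "c u \<in> \<O>" "inverse (c u) \<in> \<O>"
    using u c(1) unit_iff by blast+
  define B0 where "B0 = B - {u}"
  have B0: "finite B0" "u \<notin> B0" "x \<notin> B0" "B = insert u B0"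
    using B(1) u(1) x(2) A(2) by (auto simp: B0_def)
  define B' where "B' = insert x B0"
  have B': "finite B'" "B' \<subseteq> V" "card B' = dim V"
    using B B0 x(1) by (auto simp: B'_def)
  have pix: "scale \<pi> x = scale (c u) u + (\<Sum>b\<in>B0. scale (c b) b)"
    using c(2) B0 by simp
  have "O_span B' = adjoin A x"
  proof
    have "B' \<subseteq> adjoin A x"
      using A(2) adjoin_subset[of A x] mem_adjoin[OF A(1), of x] B0(4) by (auto simp: B'_def)
    then show "O_span B' \<subseteq> adjoin A x"
      by (intro O_span_least submod_adjoin A(1))
    have B'_sub: "B' \<subseteq> O_span B'"
      using subset_O_span B'(1) by blast
    then have "scale \<pi> x \<in> O_span B'" "\<And>b. b \<in> B0 \<Longrightarrow> scale (c b) b \<in> O_span B'"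
      using c(1) B0(4) by (auto simp: B'_def intro!: submod_scale[OF submod_O_span])
    then have "scale \<pi> x - (\<Sum>b\<in>B0. scale (c b) b) \<in> O_span B'"
      by (intro submod_diff submod_sum submod_O_span)
    then have "scale (c u) u \<in> O_span B'"
      using pix by simp
    then have "scale (inverse (c u)) (scale (c u) u) \<in> O_span B'"
      using cu(3) by (rule submod_scale[OF submod_O_span, rotated])
    then have "B \<subseteq> O_span B'"
      using B'_sub cu(1) B0(4) by (auto simp: B'_def)
    then have "A \<subseteq> O_span B'"
      unfolding B(5) by (intro O_span_least submod_O_span)
    then show "adjoin A x \<subseteq> O_span B'"
      using B'_sub by (intro adjoin_least submod_O_span) (auto simp: B'_def)
  qed
  moreover have "O_indep B'"
    unfolding O_indep_def
  proof (intro allI impI ballI)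
    fix a b assume a: "a ` B' \<subseteq> \<O>" "(\<Sum>b\<in>B'. scale (a b) b) = 0" and b: "b \<in> B'"
    \<comment> \<open>The coefficients over \<open>B\<close> of \<open>\<pi>\<close> times the given relation, after expanding \<open>\<pi>x\<close>.\<close>
    let ?e = "\<lambda>b. if b = u then a x * c u else \<pi> * a b + a x * c b"
    have "0 = scale \<pi> (scale (a x) x + (\<Sum>b\<in>B0. scale (a b) b))"
      using a(2) B0 by (simp add: B'_def)
    also have "\<dots> = scale (a x) (scale \<pi> x) + (\<Sum>b\<in>B0. scale (\<pi> * a b) b)"
      by (simp add: scale_right_distrib scale_sum_right mult.commute)
    also have "\<dots> = scale (a x * c u) u + (\<Sum>b\<in>B0. scale (\<pi> * a b + a x * c b) b)"
      unfolding pix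
      by (simp add: scale_right_distrib scale_sum_right scale_left_distrib sum.distrib)
    also have "(\<Sum>b\<in>B0. scale (\<pi> * a b + a x * c b) b) = (\<Sum>b\<in>B0. scale (?e b) b)"
      using B0(2) by (intro sum.cong) auto
    also have "scale (a x * c u) u + \<dots> = (\<Sum>b\<in>B. scale (?e b) b)"
      using B0 by simp
    finally have "(\<Sum>b\<in>B. scale (?e b) b) = 0" ..
    moreover have "?e ` B \<subseteq> \<O>"
      using a(1) c(1) cu(2) B0(4) by (auto simp: B'_def intro!: O_add O_mult)
    ultimately have e: "\<forall>b\<in>B. ?e b = 0"
      using B(4) unfolding O_indep_def by (elim allE[of _ ?e]) simp
    then have "?e u = 0"
      using u(1) by blast
    then have "a x = 0"
      using cu(1) by simp
    moreover have "a b = 0" if "b \<in> B0"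
    proof -
      have "?e b = 0"
        using e B0(4) that by blast
      then show ?thesis
        using that B0(2) \<open>a x = 0\<close> by (auto split: if_splits)
    qed
    ultimately show "a b = 0"
      using b by (auto simp: B'_def)
  qed
  ultimately show ?thesis
    unfolding lattice_iff using B' by metis
qed

text \<open>Adjoin elements of \<open>X\<close> to \<open>A\<close> until \<open>X\<close> is reached; the index decreases each time.\<close>

lemma lattice_extend:
  assumes "lattice A" "submod X" "A \<subseteq> X" "X \<subseteq> V" "scale \<pi> ` X \<subseteq> A" "index A X > 0"
  shows "lattice X"
  using assms
proof (induction "index A X" arbitrary: A rule: less_induct)
  case less
  show ?case
  proof (cases "A = X")
    case False
    then obtain x where x: "x \<in> X" "x \<notin> A" "x \<in> V" "scale \<pi> x \<in> A"
      using less.prems by blast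
    have A: "submod A"
      using less.prems submod_lattice by blast
    have sub: "A \<subseteq> adjoin A x" "adjoin A x \<subseteq> X"
      using adjoin_subset adjoin_least less.prems x by auto
    have mult: "index A X = q * index (adjoin A x) X"
      using index_mult[OF A submod_adjoin[OF A] less.prems(2) sub] index_adjoin[OF A x(2,4)]
      by simp
    show ?thesis
    proof (rule less.hyps[of "adjoin A x"])
      show "index (adjoin A x) X < index A X" "index (adjoin A x) X > 0"
        using mult q_ge_2 less.prems(6) by auto
      show "scale \<pi> ` X \<subseteq> adjoin A x"
        using less.prems(5) sub(1) by blast
    qed (use less.prems(2-4) sub lattice_adjoin[OF less.prems(1) x(3,2,4)] in simp_all)
  qed (use less.prems in simp)
qed

lemma lattice_between:
  assumes L: "lattice L" and X: "submod X" "scale \<pi> ` L \<subseteq> X" "X \<subseteq> L"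
  shows "lattice X"
proof -
  have piL: "lattice (scale \<pi> ` L)" "submod (scale \<pi> ` L)" "submod L"
    using L submod_lattice lattice_dilate[OF L pi_nz] by blast+
  have "index (scale \<pi> ` L) L = index (scale \<pi> ` L) X * index X L"
    using piL X by (intro index_mult)
  then have pos: "index (scale \<pi> ` L) X > 0"
    using index_pi_lattice[OF L] q_ge_2 by (cases "index (scale \<pi> ` L) X") auto
  have "X \<subseteq> V"
    using X(3) lattice_subset_V[OF L] by (rule subset_trans)
  from lattice_extend[OF piL(1) X(1,2) this image_mono[OF X(3)] pos] show ?thesis .
qed

end

text \<open>In dimension \<open>1\<close> no module lies strictly between \<open>\<pi>L\<close> and \<open>L\<close>, and a chamber is a single
  vertex.\<close>

locale building = lattice_space ord scale \<pi> V
  for ord :: "'k::field \<Rightarrow> int" and scale :: "'k \<Rightarrow> 'v::ab_group_add \<Rightarrow> 'v"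
    and \<pi> :: 'k and V :: "'v set" +
  assumes dim_ge_2: "dim V \<ge> 2"
begin

abbreviation cls :: "'v set \<Rightarrow> 'v set set" where
  "cls L \<equiv> homothety_class scale L"

abbreviation vertices :: "'v set set set" where
  "vertices \<equiv> building_vertices ord scale V"

abbreviation inc :: "'v set set \<Rightarrow> 'v set set \<Rightarrow> bool" where
  "inc \<equiv> incident \<pi> scale"

abbreviation simplex :: "'v set set set \<Rightarrow> bool" where
  "simplex \<equiv> building_simplex ord \<pi> scale V"

abbreviation cham :: "'v set set set \<Rightarrow> bool" where
  "cham \<equiv> chamber ord \<pi> scale V"


section \<open>Vertices and incidence\<close>

lemma mem_cls_iff: "X \<in> cls L \<longleftrightarrow> (\<exists>c. c \<noteq> 0 \<and> X = scale c ` L)"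
  by (auto simp: homothety_class_def)

lemma mem_cls [simp]: "L \<in> cls L"
  unfolding mem_cls_iff by (intro exI[of _ 1]) simp

lemma dilate_mem_cls: "c \<noteq> 0 \<Longrightarrow> scale c ` L \<in> cls L"
  unfolding mem_cls_iff by blast

lemma cls_dilate:
  assumes "c \<noteq> 0"
  shows "cls (scale c ` L) = cls L"
proof (intro equalityI subsetI)
  fix X assume "X \<in> cls (scale c ` L)"
  then obtain d where d: "d \<noteq> 0" "X = scale d ` scale c ` L"
    by (auto simp: mem_cls_iff)
  then show "X \<in> cls L"
    unfolding mem_cls_iff using assms by (intro exI[of _ "d * c"]) (simp add: dilate_dilate)
next
  fix X assume "X \<in> cls L"
  then obtain d where "d \<noteq> 0" "X = scale d ` L"
    by (auto simp: mem_cls_iff)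
  then show "X \<in> cls (scale c ` L)"
    unfolding mem_cls_iff using assms
    by (intro exI[of _ "d * inverse c"]) (simp add: dilate_dilate mult.assoc)
qed

lemma cls_eqI: "X \<in> cls L \<Longrightarrow> cls X = cls L"
  using cls_dilate by (auto simp: mem_cls_iff)

lemma cls_vertex: "lattice L \<Longrightarrow> cls L \<in> vertices"
  by (auto simp: building_vertices_def)

lemma vertex_rep:
  assumes "t \<in> vertices" "X \<in> t"
  shows "lattice X" "cls X = t"
proof -
  obtain L where L: "t = cls L" "lattice L"
    using assms(1) by (auto simp: building_vertices_def)
  then show "cls X = t"
    using assms(2) cls_eqI by simp
  obtain c where "c \<noteq> 0" "X = scale c ` L"
    using assms(2) L(1) mem_cls_iff by auto
  then show "lattice X"
    using lattice_dilate L(2) by simp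
qed

lemma vertexE:
  assumes "t \<in> vertices"
  obtains L where "lattice L" "t = cls L"
  using assms by (auto simp: building_vertices_def)

lemma pi_lattice_psubset:
  assumes "lattice L"
  shows "scale \<pi> ` L \<subset> L"
proof -
  have L: "submod L" "submod (scale \<pi> ` L)"
    using submod_lattice[OF assms] submod_dilate[OF submod_lattice[OF assms]] by simp_all
  have "1 < q ^ dim V"
    using q_ge_2 dim_ge_2 by (intro one_less_power) auto
  then have "index (scale \<pi> ` L) L \<noteq> 1"
    using index_pi_lattice[OF assms] by linarith
  then show ?thesis
    using index_self[OF L(1)] pi_dilate_subset[OF L(1)] by (metis psubsetI)
qed

text \<open>Two homothetic modules in this half-open interval differ by a scalar of valuation \<open>0\<close>,
  since a scalar of positive valuation moves everything into \<open>\<pi>L\<close>.\<close>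

lemma inj_on_cls:
  "inj_on cls {X. submod X \<and> scale \<pi> ` L \<subset> X \<and> X \<subseteq> L}"
proof -
  have not_pos: False
    if "submod X" "X \<subseteq> L" "scale \<pi> ` L \<subset> scale c ` X" "c \<noteq> 0" "ord c \<ge> 1" for X c
  proof -
    have "scale c ` X \<subseteq> scale \<pi> ` X"
      using that by (intro dilate_subset) auto
    also have "\<dots> \<subseteq> scale \<pi> ` L"
      using that(2) by (rule image_mono)
    finally show False using that(3) by blast
  qed
  show ?thesis
  proof (rule inj_onI)
    fix X Y assume "X \<in> {X. submod X \<and> scale \<pi> ` L \<subset> X \<and> X \<subseteq> L}"
      and "Y \<in> {X. submod X \<and> scale \<pi> ` L \<subset> X \<and> X \<subseteq> L}"
      and eq: "cls X = cls Y"
    then have X: "submod X" "scale \<pi> ` L \<subset> X" "X \<subseteq> L"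
      and Y: "submod Y" "scale \<pi> ` L \<subset> Y" "Y \<subseteq> L"
      by simp_all
    have "Y \<in> cls X"
      using eq mem_cls by simp
    then obtain c where c: "c \<noteq> 0" "Y = scale c ` X"
      using mem_cls_iff by auto
    have X': "X = scale (inverse c) ` Y"
      using c by (simp add: dilate_dilate)
    consider "ord c \<ge> 1" | "ord c = 0" | "ord (inverse c) \<ge> 1"
      using ord_inverse[OF c(1)] by linarith
    then show "X = Y"
    proof cases
      case 1
      then show ?thesis
        using not_pos[of X c] X Y c by simp
    next
      case 2
      then show ?thesis
        using dilate_eq[OF X(1) c(1), of 1] c(2) by simp
    next
      case 3
      then show ?thesis
        using not_pos[of Y "inverse c"] X Y c(1) X' by simp
    qed
  qed
qed

lemma cls_eq_iff:
  assumes "submod X" "scale \<pi> ` L \<subset> X" "X \<subseteq> L" "submod Y" "scale \<pi> ` L \<subset> Y" "Y \<subseteq> L"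
  shows "cls X = cls Y \<longleftrightarrow> X = Y"
  using inj_on_eq_iff[OF inj_on_cls[of L], of X Y] assms by simp

lemma same_vertex_comparable:
  assumes "t \<in> vertices" "X \<in> t" "Y \<in> t"
  shows "X \<subseteq> Y \<or> Y \<subseteq> X"
proof -
  have X: "submod X" "cls X = t"
    using vertex_rep[OF assms(1,2)] submod_lattice by auto
  then obtain c where c: "c \<noteq> 0" "Y = scale c ` X"
    using assms(3) mem_cls_iff by blast
  show ?thesis
  proof (cases "ord c \<ge> 0")
    case True
    then show ?thesis
      using dilate_subset[OF X(1) c(1), of 1] c(2) by simp
  next
    case False
    then show ?thesis
      using dilate_subset[OF X(1) _ c(1), of 1] c(2) by simp
  qed
qed

text \<open>Incidence concerns one pair of representatives. The scaled copies of \<open>L\<close> and \<open>L'\<close> form a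
  single chain in which they alternate, so all other pairs are comparable too.\<close>

lemma incident_comparable:
  assumes "t \<in> vertices" "t' \<in> vertices" "inc t t'" "X \<in> t" "Y \<in> t'"
  shows "X \<subseteq> Y \<or> Y \<subseteq> X"
proof -
  obtain L L' where L: "L \<in> t" "L' \<in> t'" "scale \<pi> ` L \<subseteq> L'" "L' \<subseteq> L"
    using assms(3) by (auto simp: incident_def)
  have subm: "submod L" "submod L'"
    using L vertex_rep(1) submod_lattice assms(1,2) by blast+
  have "X \<in> cls L" "Y \<in> cls L'"
    using vertex_rep(2)[OF assms(1) L(1)] vertex_rep(2)[OF assms(2) L(2)] assms(4,5) by simp_all
  then obtain a b where ab: "a \<noteq> 0" "X = scale a ` L" "b \<noteq> 0" "Y = scale b ` L'"
    using mem_cls_iff by auto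
  show ?thesis
  proof (cases "ord a \<le> ord b")
    case True
    have "Y \<subseteq> scale b ` L"
      unfolding ab(4) using L(4) by (rule image_mono)
    also have "\<dots> \<subseteq> X"
      unfolding ab(2) using subm(1) ab(3,1) True by (rule dilate_subset)
    finally show ?thesis ..
  next
    case False
    then have "X \<subseteq> scale (b * \<pi>) ` L"
      unfolding ab(2) using subm(1) ab(1,3) ord_mult[OF ab(3) pi_nz]
      by (intro dilate_subset) auto
    also have "\<dots> = scale b ` scale \<pi> ` L"
      by (simp only: dilate_dilate)
    also have "\<dots> \<subseteq> Y"
      unfolding ab(4) using L(3) by (rule image_mono)
    finally show ?thesis ..
  qed
qed

lemma incident_between:
  assumes "scale \<pi> ` L \<subseteq> X" "X \<subseteq> Y" "Y \<subseteq> L"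
  shows "inc (cls X) (cls Y)" "inc (cls Y) (cls X)"
proof -
  have "scale \<pi> ` Y \<subseteq> X"
    using image_mono[OF assms(3), of "scale \<pi>"] assms(1) by (rule subset_trans)
  then show "inc (cls Y) (cls X)"
    unfolding incident_def using assms(2) by (intro bexI[of _ Y] bexI[of _ X]) simp_all
  have "scale \<pi> ` X \<subseteq> scale \<pi> ` Y"
    using assms(2) by (rule image_mono)
  then show "inc (cls X) (cls Y)"
    unfolding incident_def using \<open>scale \<pi> ` Y \<subseteq> X\<close> dilate_mem_cls[OF pi_nz]
    by (intro bexI[of _ X] bexI[of _ "scale \<pi> ` Y"]) simp_all
qed

lemma incident_rep:
  assumes L: "lattice L" and "inc (cls L) t"  "t \<in> vertices"
  obtains X where "X \<in> t" "scale \<pi> ` L \<subseteq> X" "X \<subseteq> L"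
proof -
  obtain M M' where M: "M \<in> cls L" "M' \<in> t" "scale \<pi> ` M \<subseteq> M'" "M' \<subseteq> M"
    using assms(2) by (auto simp: incident_def)
  obtain c where c: "c \<noteq> 0" "M = scale c ` L"
    using M(1) mem_cls_iff by auto
  let ?X = "scale (inverse c) ` M'"
  have "?X \<in> cls M'"
    using c(1) by (intro dilate_mem_cls) simp
  then have "?X \<in> t"
    using vertex_rep(2)[OF assms(3) M(2)] by simp
  moreover have "scale (inverse c) ` scale \<pi> ` M \<subseteq> ?X"
    using M(3) by (rule image_mono)
  then have "scale \<pi> ` L \<subseteq> ?X"
    using c by (simp add: dilate_dilate mult.commute[of _ c] mult.assoc[symmetric])
  moreover have "?X \<subseteq> scale (inverse c) ` M"
    using M(4) by (rule image_mono)
  then have "?X \<subseteq> L"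
    using c by (simp add: dilate_dilate)
  ultimately show ?thesis ..
qed

lemma simplexD:
  assumes "simplex S"
  shows "s \<in> S \<Longrightarrow> s \<in> vertices" "s \<in> S \<Longrightarrow> s' \<in> S \<Longrightarrow> s \<noteq> s' \<Longrightarrow> inc s s'" "finite S"
  using assms by (auto simp: building_simplex_def pairwise_def)

lemma simplex_comparable:
  assumes S: "simplex S" and s: "s \<in> S" "s' \<in> S" "X \<in> s" "Y \<in> s'"
  shows "X \<subseteq> Y \<or> Y \<subseteq> X"
proof (cases "s = s'")
  case True
  then show ?thesis
    using same_vertex_comparable[OF simplexD(1)[OF S s(1)] s(3)] s(4) by simp
next
  case False
  then show ?thesis
    using incident_comparable[OF simplexD(1)[OF S s(1)] simplexD(1)[OF S s(2)]
        simplexD(2)[OF S s(1,2)] s(3,4)] by simp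
qed

lemma simplex_rep:
  assumes S: "simplex S" and L: "lattice L" "cls L \<in> S" and s: "s \<in> S"
  obtains X where "X \<in> s" "scale \<pi> ` L \<subseteq> X" "X \<subseteq> L"
proof (cases "s = cls L")
  case True
  then show ?thesis
    using that[of L] pi_dilate_subset[OF submod_lattice[OF L(1)]] by simp
next
  case False
  then show ?thesis
    using incident_rep[OF L(1) simplexD(2)[OF S L(2) s] simplexD(1)[OF S s]] that by metis
qed

lemma simplex_insert:
  assumes "simplex S" "t \<in> vertices"
    and "\<And>s. s \<in> S \<Longrightarrow> s \<noteq> t \<Longrightarrow> inc s t \<and> inc t s"
  shows "simplex (insert t S)"
  using assms unfolding building_simplex_def pairwise_insert by auto

lemma cham_simplex: "cham C \<Longrightarrow> simplex C"
  by (auto simp: chamber_def)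

lemma cham_maximal: "cham C \<Longrightarrow> simplex (insert t C) \<Longrightarrow> t \<in> C"
  unfolding chamber_def by blast


section \<open>Chambers through a vertex\<close>

lemma simplex_of_chain:
  assumes L: "lattice L" and E: "finite E" "E \<subseteq> interval (scale \<pi> ` L) L"
    and chain: "\<And>X Y. X \<in> E \<Longrightarrow> Y \<in> E \<Longrightarrow> X \<subseteq> Y \<or> Y \<subseteq> X"
  shows "simplex (cls ` E)"
  unfolding building_simplex_def
proof (intro conjI)
  show "cls ` E \<subseteq> vertices"
    using E(2) lattice_between[OF L] cls_vertex by (auto simp: interval_def)
  show "pairwise inc (cls ` E)"
    unfolding pairwise_def
  proof (intro ballI impI)
    fix s s' assume "s \<in> cls ` E" "s' \<in> cls ` E"
    then obtain X Y where XY: "X \<in> E" "Y \<in> E" "s = cls X" "s' = cls Y"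
      by blast
    have "scale \<pi> ` L \<subseteq> X" "X \<subseteq> L" "scale \<pi> ` L \<subseteq> Y" "Y \<subseteq> L"
      using XY(1,2) E(2) by (auto simp: interval_def)
    then show "inc s s'"
      using chain[OF XY(1,2)] incident_between[of L X Y] incident_between[of L Y X] XY(3,4)
      by metis
  qed
qed (use E in simp)

lemma lattice_maxchainD:
  assumes L: "lattice L" and E: "E \<in> maxchains (scale \<pi> ` L) L"
  shows "finite E" "L \<in> E" "simplex (cls ` E)"
proof -
  have sub: "submod L" "submod (scale \<pi> ` L)"
    using submod_lattice[OF L] submod_dilate[OF submod_lattice[OF L]] by simp_all
  show fin: "finite E"
    using finite_maxchain[OF sub(2) _ E] index_pi_lattice[OF L] q_ge_2 by simp
  show "L \<in> E"
    using top_in_maxchain[OF E sub(1) pi_dilate_subset[OF sub(1)]] .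
  show "simplex (cls ` E)"
    using E by (intro simplex_of_chain[OF L fin]) (auto simp: maxchains_def)
qed

text \<open>The chain can be recovered from its chamber: the elements of a simplex have pairwise
  comparable representatives, so maximality of the chain collects all of those between \<open>\<pi>L\<close> and
  \<open>L\<close>.\<close>

lemma maxchain_eq_reps:
  assumes L: "lattice L" and E: "E \<in> maxchains (scale \<pi> ` L) L"
  shows "E = {X \<in> \<Union> (cls ` E). scale \<pi> ` L \<subseteq> X \<and> X \<subseteq> L}"
proof (intro equalityI subsetI)
  fix X assume "X \<in> E"
  then show "X \<in> {X \<in> \<Union> (cls ` E). scale \<pi> ` L \<subseteq> X \<and> X \<subseteq> L}"
    using maxchainsD(2,3)[OF E, of X] by (auto intro: bexI[of _ X])
next
  fix X assume X: "X \<in> {X \<in> \<Union> (cls ` E). scale \<pi> ` L \<subseteq> X \<and> X \<subseteq> L}"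
  then obtain s where s: "s \<in> cls ` E" "X \<in> s"
    unfolding mem_Collect_eq Union_iff by (elim conjE bexE)
  note S = lattice_maxchainD(3)[OF L E]
  have "submod X"
    by (intro submod_lattice vertex_rep(1)[OF simplexD(1)[OF S s(1)] s(2)])
  then show "X \<in> E"
  proof (rule maxchains_maximal[OF E])
    show "X \<subseteq> Y \<or> Y \<subseteq> X" if "Y \<in> E" for Y
      using simplex_comparable[OF S s(1) imageI[OF that] s(2) mem_cls] .
  qed (use X in auto)
qed

lemma cham_of_maxchain:
  assumes L: "lattice L" and E: "E \<in> maxchains (scale \<pi> ` L) L"
  shows "cham (cls ` E)"
  unfolding chamber_def
proof (intro conjI allI impI)
  note ED = lattice_maxchainD[OF L E]
  show "simplex (cls ` E)" by (rule ED(3))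
  fix S assume S: "simplex S \<and> cls ` E \<subseteq> S"
  have "s \<in> cls ` E" if s: "s \<in> S" for s
  proof -
    obtain X where X: "X \<in> s" "scale \<pi> ` L \<subseteq> X" "X \<subseteq> L"
      using simplex_rep[of S L s] S L ED(2) s by (metis imageI subsetD)
    have Xs: "submod X" "cls X = s"
      using vertex_rep[OF _ X(1)] simplexD(1)[of S s] S s submod_lattice by auto
    have "X \<in> E"
    proof (rule maxchains_maximal[OF E Xs(1) X(2,3)])
      show "X \<subseteq> Y \<or> Y \<subseteq> X" if "Y \<in> E" for Y
        using simplex_comparable[of S s "cls Y" X Y] S s X(1) that by auto
    qed
    then show ?thesis using Xs(2) by blast
  qed
  then show "S = cls ` E" using S by blast
qed

text \<open>A module comparable with the whole chain has a class incident to all members of the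
  chamber, so the class, and with it the module, was there already.\<close>

lemma maxchain_of_cham:
  assumes L: "lattice L" and C: "cham C" "cls L \<in> C"
  obtains E where "E \<in> maxchains (scale \<pi> ` L) L" "C = cls ` E"
proof -
  note S = cham_simplex[OF C(1)]
  define E where "E = {X \<in> \<Union> C. scale \<pi> ` L \<subseteq> X \<and> X \<subseteq> L}"
  have rep: "submod X \<and> cls X \<in> C" if XE: "X \<in> E" for X
  proof -
    obtain s where "s \<in> C" "X \<in> s"
      using XE by (auto simp: E_def)
    then show ?thesis
      using vertex_rep[of s X] simplexD(1)[OF S] submod_lattice by auto
  qed
  have comp: "X \<subseteq> Y \<or> Y \<subseteq> X" if "X \<in> E" "Y \<in> E" for X Y
    using simplex_comparable[OF S, of "cls X" "cls Y" X Y] rep that by simp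
  have int: "E \<subseteq> interval (scale \<pi> ` L) L"
    using rep by (auto simp: E_def interval_def)
  have fin: "finite E"
    using int finite_interval[of "scale \<pi> ` L" L] submod_dilate[OF submod_lattice[OF L]]
      index_pi_lattice[OF L] q_ge_2 finite_subset by simp
  have "C \<subseteq> cls ` E"
  proof
    fix s assume s: "s \<in> C"
    obtain X where X: "X \<in> s" "scale \<pi> ` L \<subseteq> X" "X \<subseteq> L"
      using simplex_rep[OF S L C(2) s] .
    then have "X \<in> E" "cls X = s"
      using s vertex_rep(2)[OF simplexD(1)[OF S s] X(1)] by (auto simp: E_def)
    then show "s \<in> cls ` E" by blast
  qed
  moreover have "cls ` E \<subseteq> C"
    using rep by blast
  ultimately have CE: "C = cls ` E" by blast
  have "E \<in> maxchains (scale \<pi> ` L) L"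
  proof (rule maxchainsI[OF int comp])
    fix X assume X: "X \<in> interval (scale \<pi> ` L) L" "\<And>Y. Y \<in> E \<Longrightarrow> X \<subseteq> Y \<or> Y \<subseteq> X"
    have "simplex (cls ` insert X E)"
    proof (rule simplex_of_chain[OF L])
      show "A \<subseteq> B \<or> B \<subseteq> A" if "A \<in> insert X E" "B \<in> insert X E" for A B
        using that comp X(2) by blast
    qed (use fin int X(1) in auto)
    then have "cls X \<in> C"
      using cham_maximal[OF C(1)] CE by simp
    then show "X \<in> E"
      using X(1) by (auto simp: E_def interval_def intro: bexI[of _ "cls X"])
  qed
  then show ?thesis using CE that by blast
qed

theorem card_chambers_containing:
  assumes L: "lattice L"
  shows "finite (chambers_containing ord \<pi> scale V (cls L))"
    and "card (chambers_containing ord \<pi> scale V (cls L)) = flag_count q (dim V)"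
proof -
  have sub: "submod L" "submod (scale \<pi> ` L)" "scale \<pi> ` L \<subseteq> L"
    using submod_lattice[OF L] submod_dilate[OF submod_lattice[OF L]]
      pi_dilate_subset[OF submod_lattice[OF L]] by simp_all
  have "bij_betw (\<lambda>E. cls ` E) (maxchains (scale \<pi> ` L) L)
          (chambers_containing ord \<pi> scale V (cls L))"
    unfolding bij_betw_def
  proof (intro conjI equalityI subsetI)
    show "inj_on (\<lambda>E. cls ` E) (maxchains (scale \<pi> ` L) L)"
      using maxchain_eq_reps[OF L] by (intro inj_onI) metis
    show "C \<in> chambers_containing ord \<pi> scale V (cls L)"
      if "C \<in> (\<lambda>E. cls ` E) ` maxchains (scale \<pi> ` L) L" for C
      using that cham_of_maxchain[OF L] lattice_maxchainD(2)[OF L]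
      by (auto simp: chambers_containing_def)
    show "C \<in> (\<lambda>E. cls ` E) ` maxchains (scale \<pi> ` L) L"
      if C: "C \<in> chambers_containing ord \<pi> scale V (cls L)" for C
    proof -
      obtain E where "E \<in> maxchains (scale \<pi> ` L) L" "C = cls ` E"
        using C maxchain_of_cham[OF L, of C] unfolding chambers_containing_def by blast
      then show ?thesis by blast
    qed
  qed
  moreover have "finite (maxchains (scale \<pi> ` L) L) \<and>
      card (maxchains (scale \<pi> ` L) L) = flag_count q (dim V)"
    using sub index_pi_lattice[OF L] by (intro card_maxchains) auto
  ultimately show "finite (chambers_containing ord \<pi> scale V (cls L))"
    and "card (chambers_containing ord \<pi> scale V (cls L)) = flag_count q (dim V)"
    using bij_betw_finite bij_betw_same_card by metis+
qed


section \<open>Panels between two vertices\<close>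

text \<open>The members next to the ends of a maximal chain from \<open>\<pi>L\<close> to \<open>L\<close>; what a chamber through
  \<open>[L]\<close> adds to \<open>[L]\<close> is a chain between them.\<close>

definition frame :: "'v set \<Rightarrow> 'v set \<Rightarrow> 'v set \<Rightarrow> bool" where
  "frame L Q P \<longleftrightarrow> covers (scale \<pi> ` L) Q \<and> Q \<subseteq> P \<and> covers P L"

lemma frameD:
  assumes "frame L Q P"
  shows "submod L" "submod Q" "submod P" "scale \<pi> ` L \<subset> Q" "Q \<subseteq> P" "P \<subset> L"
    and "scale \<pi> ` Q \<subseteq> scale \<pi> ` P" "scale \<pi> ` P \<subset> scale \<pi> ` L"
    and "covers (scale \<pi> ` L) Q" "covers (scale \<pi> ` P) (scale \<pi> ` L)" "covers P L"
proof -
  show *: "covers (scale \<pi> ` L) Q" "Q \<subseteq> P" "covers P L"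
    using assms by (auto simp: frame_def)
  then show "submod L" "submod Q" "submod P" "scale \<pi> ` L \<subset> Q" "P \<subset> L"
    by (auto simp: covers_def)
  show "covers (scale \<pi> ` P) (scale \<pi> ` L)"
    using covers_dilate[OF pi_nz *(3)] .
  then show "scale \<pi> ` P \<subset> scale \<pi> ` L"
    by (auto simp: covers_def)
  show "scale \<pi> ` Q \<subseteq> scale \<pi> ` P"
    using *(2) by (rule image_mono)
qed

lemma frame_index:
  assumes L: "lattice L" and fr: "frame L Q P"
  shows "index Q P = q ^ (dim V - 2)" "scale \<pi> ` P \<subseteq> Q" "index (scale \<pi> ` P) Q = q ^ 2"
proof -
  note F = frameD[OF fr]
  have sub: "submod (scale \<pi> ` L)" "submod (scale \<pi> ` P)"
    using submod_dilate F(1,3) by simp_all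
  have "scale \<pi> ` Q \<subseteq> scale \<pi> ` L"
    using F(5,6) by (intro image_mono) simp
  then have 1: "index (scale \<pi> ` L) Q = q"
    using index_covers[OF F(9)] by simp
  have "scale \<pi> ` L \<subseteq> P"
    using F(4,5) by simp
  then have 2: "index P L = q"
    using index_covers[OF F(11)] by simp
  show "scale \<pi> ` P \<subseteq> Q"
    using F(4,8) by simp
  have "index (scale \<pi> ` P) Q = index (scale \<pi> ` P) (scale \<pi> ` L) * index (scale \<pi> ` L) Q"
    using F sub by (intro index_mult) simp_all
  then show "index (scale \<pi> ` P) Q = q ^ 2"
    using 1 2 index_dilate[OF F(3) pi_nz] by (simp add: power2_eq_square)
  have "index (scale \<pi> ` L) L = index (scale \<pi> ` L) Q * index Q L"
    using F sub by (intro index_mult) (simp_all add: less_imp_le)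
  also have "index Q L = index Q P * index P L"
    using F by (intro index_mult) simp_all
  finally have "q ^ 2 * index Q P = q ^ dim V"
    using 1 2 index_pi_lattice[OF L] by (simp add: power2_eq_square)
  also have "dim V = 2 + (dim V - 2)"
    using dim_ge_2 by simp
  finally have "q ^ 2 * index Q P = q ^ 2 * q ^ (dim V - 2)"
    by (simp only: power_add)
  then show "index Q P = q ^ (dim V - 2)"
    using q_ge_2 by simp
qed

lemma card_maxchains_frame:
  assumes L: "lattice L" and fr: "frame L Q P"
  shows "finite (maxchains Q P)" "card (maxchains Q P) = flag_count q (dim V - 2)"
  using card_maxchains[of Q P] frameD[OF fr] frame_index[OF L fr] by simp_all

lemma frame_cls_notin:
  assumes fr: "frame L Q P" and D: "D \<in> maxchains Q P"
  shows "cls L \<notin> cls ` D"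
proof
  note F = frameD[OF fr]
  assume "cls L \<in> cls ` D"
  then obtain X where X: "X \<in> D" "cls L = cls X"
    by blast
  have "submod X" "Q \<subseteq> X" "X \<subseteq> P"
    using maxchainsD[OF D X(1)] by simp_all
  moreover from this have "scale \<pi> ` L \<subset> X" "X \<subset> L"
    using F by (meson psubset_subset_trans subset_psubset_trans)+
  moreover have "scale \<pi> ` L \<subset> L"
    using F by (meson psubset_subset_trans psubset_trans)
  ultimately show False
    using cls_eq_iff[of L L X] X(2) F(1) by auto
qed

lemma cham_of_frame:
  assumes L: "lattice L" and fr: "frame L Q P" and D: "D \<in> maxchains Q P"
  shows "cham (insert (cls L) (cls ` D))"
proof -
  note F = frameD[OF fr]
  have "insert L D \<in> maxchains Q L"
    using maxchain_insert_top[OF F(11,5) D] .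
  moreover have "Q \<subseteq> L"
    using F(5,6) by simp
  ultimately have "insert (scale \<pi> ` L) (insert L D) \<in> maxchains (scale \<pi> ` L) L"
    using maxchain_insert_bot[OF F(9)] by simp
  then have "cham (cls ` insert (scale \<pi> ` L) (insert L D))"
    by (rule cham_of_maxchain[OF L])
  then show ?thesis
    using cls_dilate[OF pi_nz] by simp
qed

lemma frame_of_cham:
  assumes L: "lattice L" and C: "cham (insert (cls L) F)" "cls L \<notin> F"
  obtains Q P D where "frame L Q P" "D \<in> maxchains Q P" "F = cls ` D"
proof -
  have sub: "submod L" "submod (scale \<pi> ` L)"
    using submod_lattice[OF L] submod_dilate by simp_all
  obtain E where E: "E \<in> maxchains (scale \<pi> ` L) L" "insert (cls L) F = cls ` E"
    using maxchain_of_cham[OF L C(1)] by blast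
  note fin = lattice_maxchainD(1)[OF L E(1)]
  obtain Q D1 where Q: "covers (scale \<pi> ` L) Q" "Q \<subseteq> L" "D1 \<in> maxchains Q L"
      "E = insert (scale \<pi> ` L) D1"
    using maxchain_remove_bot[OF sub(2,1) pi_lattice_psubset[OF L] E(1) fin] .
  have "Q \<noteq> L"
  proof
    assume "Q = L"
    then have "q ^ dim V = q ^ 1"
      using index_covers[OF Q(1)] index_pi_lattice[OF L] by simp
    then show False
      using q_ge_2 dim_ge_2 power_inject_exp[of q "dim V" 1] by simp
  qed
  then have "Q \<subset> L" "submod Q" "finite D1"
    using Q fin by (auto simp: covers_def)
  then obtain P D where P: "covers P L" "Q \<subseteq> P" "D \<in> maxchains Q P" "D1 = insert L D"
    using maxchain_remove_top[of Q L D1] sub(1) Q(3) by blast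
  have fr: "frame L Q P"
    using P Q by (simp add: frame_def)
  have "insert (cls L) F = insert (cls L) (cls ` D)"
    using E(2) Q(4) P(4) cls_dilate[OF pi_nz] by simp
  then have "F = cls ` D"
    using insert_ident[OF C(2) frame_cls_notin[OF fr P(3)]] by simp
  then show ?thesis
    using that fr P(3) by blast
qed

text \<open>For close vertices these faces parametrize the galleries from \<open>t\<close> to \<open>t'\<close>, a gallery being
  determined by the common face of its two chambers.\<close>

definition panels :: "'v set set \<Rightarrow> 'v set set \<Rightarrow> 'v set set set set" where
  "panels t t' = {F. t \<notin> F \<and> t' \<notin> F \<and> cham (insert t F) \<and> cham (insert t' F)}"

text \<open>Otherwise \<open>t\<close> and \<open>t'\<close> together with the panel would form a simplex larger than a chamber.\<close>

lemma panels_not_incident: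
  assumes F: "F \<in> panels t t'" and "t \<noteq> t'"
  shows "\<not> (inc t t' \<and> inc t' t)"
proof
  assume inc: "inc t t' \<and> inc t' t"
  have F': "t \<notin> F" "cham (insert t F)" "cham (insert t' F)"
    using F by (auto simp: panels_def)
  have S: "simplex (insert t F)" "simplex (insert t' F)"
    using cham_simplex F' by blast+
  have "simplex (insert t (insert t' F))"
  proof (rule simplex_insert[OF S(2)])
    show "t \<in> vertices"
      using simplexD(1)[OF S(1)] by simp
    show "inc s t \<and> inc t s" if "s \<in> insert t' F" "s \<noteq> t" for s
      using that inc simplexD(2)[OF S(1)] by auto
  qed
  then have "t \<in> insert t' F"
    by (rule cham_maximal[OF F'(3)])
  then show False
    using F'(1) assms(2) by simp
qed

text \<open>Incidence with \<open>[P]\<close> places a representative \<open>Y\<close> between \<open>\<pi>P\<close> and \<open>P\<close>, and it is comparable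
  with \<open>Q\<close>. It cannot lie above \<open>Q\<close>, because \<open>t'\<close> is not incident to \<open>[L]\<close>.\<close>

lemma panel_opposite_rep:
  assumes L: "lattice L" and fr: "frame L Q P" and D: "D \<in> maxchains Q P"
    and F: "cls ` D \<in> panels (cls L) t'" and neq: "cls L \<noteq> t'"
  obtains Y where "Y \<in> t'" "submod Y" "scale \<pi> ` P \<subset> Y" "Y \<subset> Q" "Y \<noteq> scale \<pi> ` L"
proof -
  note FD = frameD[OF fr]
  have t': "t' \<notin> cls ` D" "cham (insert t' (cls ` D))"
    using F by (auto simp: panels_def)
  note S = cham_simplex[OF t'(2)]
  have vt': "t' \<in> vertices"
    using simplexD(1)[OF S] by simp
  have QP: "Q \<in> D" "P \<in> D"
    using bot_in_maxchain[OF D FD(2,5)] top_in_maxchain[OF D FD(3,5)] .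
  have latP: "lattice P"
    using lattice_between[OF L FD(3)] FD(4-6) by auto
  have "inc (cls P) t'"
    using simplexD(2)[OF S, of "cls P" t'] QP(2) t'(1) by auto
  then obtain Y where Y: "Y \<in> t'" "scale \<pi> ` P \<subseteq> Y" "Y \<subseteq> P"
    using incident_rep[OF latP _ vt'] by blast
  have Yt: "submod Y" "cls Y = t'"
    using vertex_rep[OF vt' Y(1)] submod_lattice by auto
  have ne: "Y \<noteq> scale \<pi> ` P" "Y \<noteq> Q" "Y \<noteq> scale \<pi> ` L"
    using Yt(2) t'(1) QP neq cls_dilate[OF pi_nz] by auto
  have "Y \<subseteq> Q \<or> Q \<subseteq> Y"
    using simplex_comparable[OF S, of t' "cls Q" Y Q] QP(1) Y(1) by simp
  moreover have "\<not> Q \<subseteq> Y"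
  proof
    \<comment> \<open>Such a representative lies between \<open>\<pi>L\<close> and \<open>L\<close>, which makes \<open>t'\<close> incident to \<open>[L]\<close>.\<close>
    assume "Q \<subseteq> Y"
    then have "scale \<pi> ` L \<subseteq> Y" "Y \<subseteq> L"
      using FD(4,6) Y(3) by auto
    then have "inc (cls L) t' \<and> inc t' (cls L)"
      using incident_between[of L Y L] Yt(2) by simp
    then show False
      using panels_not_incident[OF F neq] by simp
  qed
  ultimately show ?thesis
    using that[of Y] Y ne Yt(1) by blast
qed

text \<open>The pair \<open>\<pi>P\<close>, \<open>Q\<close> has index \<open>q\<^sup>2\<close>, so \<open>Y\<close> covers \<open>\<pi>P\<close> and is covered by \<open>Q\<close>, just as \<open>\<pi>L\<close>.
  With \<open>\<pi>\<^sup>-\<^sup>1Y\<close> in the role of \<open>L\<close>, the same \<open>Q\<close> and \<open>P\<close> bound the chambers through \<open>[Y]\<close>.\<close>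

lemma panel_of_opposite:
  assumes L: "lattice L" and fr: "frame L Q P"
    and Y: "submod Y" "scale \<pi> ` P \<subset> Y" "Y \<subset> Q" "Y \<noteq> scale \<pi> ` L"
  shows "cls L \<noteq> cls Y" "cls Y \<in> vertices"
    and "D \<in> maxchains Q P \<Longrightarrow> cls ` D \<in> panels (cls L) (cls Y)"
proof -
  note FD = frameD[OF fr]
  have latP: "lattice P"
    using lattice_between[OF L FD(3)] FD(4-6) by auto
  have YP: "Y \<subseteq> P"
    using Y(3) FD(5) by auto
  have latY: "lattice Y"
    using lattice_between[OF latP Y(1) _ YP] Y(2) by auto
  then show "cls Y \<in> vertices"
    by (rule cls_vertex)
  have "cls (scale \<pi> ` L) \<noteq> cls Y"
    using cls_eq_iff[of "scale \<pi> ` L" P Y] submod_dilate[OF FD(1)] FD(4,5,8) Y YP by auto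
  then show neq: "cls L \<noteq> cls Y"
    using cls_dilate[OF pi_nz] by simp
  show "cls ` D \<in> panels (cls L) (cls Y)" if D: "D \<in> maxchains Q P"
  proof -
    define M where "M = scale (inverse \<pi>) ` Y"
    have M: "lattice M" "scale \<pi> ` M = Y" "cls M = cls Y"
      using lattice_dilate[OF latY] cls_dilate[of "inverse \<pi>" Y]
      by (simp_all add: M_def dilate_dilate)
    have cov: "covers (scale \<pi> ` P) Y" "covers Y Q"
      using covers_of_index_square[OF _ Y(1) FD(2) Y(2,3) FD(7)] frame_index(3)[OF L fr]
        submod_dilate[OF FD(3)] by simp_all
    have "covers (scale (inverse \<pi>) ` scale \<pi> ` P) M"
      unfolding M_def using cov(1) by (intro covers_dilate) simp_all
    then have "covers P M"
      by (simp add: dilate_dilate)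
    then have frM: "frame M Q P"
      using cov(2) M(2) FD(5) by (simp add: frame_def)
    show ?thesis
      using frame_cls_notin[OF fr D] frame_cls_notin[OF frM D] cham_of_frame[OF L fr D]
        cham_of_frame[OF M(1) frM D] M(3) by (simp add: panels_def)
  qed
qed

lemma covers_Int_eq:
  assumes "covers A M" "submod Y" "A \<subseteq> Y" "\<not> M \<subseteq> Y"
  shows "M \<inter> Y = A"
  using covers_eq[OF assms(1), of "M \<inter> Y"] submod_Int[of M Y] assms by (auto simp: covers_def)

text \<open>Once \<open>Y\<close> and \<open>Y'\<close> are known to be equal, \<open>\<pi>P = \<pi>L \<inter> Y\<close> and the minimality of \<open>Q\<close> above \<open>\<pi>L\<close>
  determine \<open>P\<close> and \<open>Q\<close>. The two representatives are homothetic, so it remains to exclude a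
  scalar of nonzero valuation. If \<open>Y' \<subseteq> \<pi>Y\<close>, then \<open>\<pi>P' \<subseteq> \<pi>P\<close>, and both are covered by \<open>\<pi>L\<close>, so
  they agree; but then \<open>\<pi>P \<subset> Y' \<subseteq> \<pi>Y \<subseteq> \<pi>Q \<subseteq> \<pi>P\<close>.\<close>

lemma frame_unique:
  assumes fr: "frame L Q P" "frame L Q' P'" and t': "t' \<in> vertices"
    and Y: "Y \<in> t'" "scale \<pi> ` P \<subset> Y" "Y \<subset> Q" "Y \<noteq> scale \<pi> ` L"
    and Y': "Y' \<in> t'" "scale \<pi> ` P' \<subset> Y'" "Y' \<subset> Q'" "Y' \<noteq> scale \<pi> ` L"
  shows "Q' = Q" "P' = P"
proof -
  let ?M = "scale \<pi> ` L"
  have not_sub: "\<not> ?M \<subseteq> Z" if "frame L R S" "submod Z" "Z \<subset> R" "Z \<noteq> ?M" for Z R S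
    using covers_eq[OF frameD(9)[OF that(1)], of Z] that by blast
  have not_pos: False
    if fr: "frame L Q P" "frame L Q' P'"
      and Y: "submod Y" "scale \<pi> ` P \<subset> Y" "Y \<subset> Q" "Y \<noteq> ?M"
      and Y': "submod Y'" "scale \<pi> ` P' \<subset> Y'" "Y' \<subset> Q'" "Y' \<noteq> ?M"
      and c: "Y' = scale c ` Y" "c \<noteq> 0" "ord c \<ge> 1"
    for Q P Q' P' Y Y' c
  proof -
    note F = frameD[OF fr(1)] and F' = frameD[OF fr(2)]
    have Y'_sub: "Y' \<subseteq> scale \<pi> ` Y"
      unfolding c(1) using Y(1) c by (intro dilate_subset) auto
    have int: "?M \<inter> Y = scale \<pi> ` P" "?M \<inter> Y' = scale \<pi> ` P'"
      using covers_Int_eq[OF F(10) Y(1)] covers_Int_eq[OF F'(10) Y'(1)] Y Y'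
        not_sub[OF fr(1) Y(1,3,4)] not_sub[OF fr(2) Y'(1,3,4)] by auto
    have "Y' \<subseteq> Y"
      using Y'_sub pi_dilate_subset[OF Y(1)] by (rule subset_trans)
    then have "scale \<pi> ` P' \<subseteq> scale \<pi> ` P"
      using Int_mono[OF subset_refl, of Y' Y ?M] int by simp
    then have "scale \<pi> ` P = scale \<pi> ` P'"
      using covers_eq[OF F'(10) submod_dilate[OF F(3)] _ less_imp_le[OF F(8)]] F(8) by blast
    also have "\<dots> \<subset> Y'" by (rule Y'(2))
    also have "Y' \<subseteq> scale \<pi> ` Y" by (rule Y'_sub)
    also have "\<dots> \<subseteq> scale \<pi> ` Q"
      using Y(3) by (intro image_mono) simp
    also have "\<dots> \<subseteq> scale \<pi> ` P" by (rule F(7))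
    finally show False by simp
  qed
  note F = frameD[OF fr(1)] and F' = frameD[OF fr(2)]
  have sub: "submod Y" "submod Y'"
    using vertex_rep(1)[OF t'] Y(1) Y'(1) submod_lattice by simp_all
  have "Y' \<in> cls Y"
    using vertex_rep(2)[OF t' Y(1)] Y'(1) by simp
  then obtain c where c: "c \<noteq> 0" "Y' = scale c ` Y"
    using mem_cls_iff by auto
  have "Y = scale (inverse c) ` Y'"
    using c by (simp add: dilate_dilate)
  then have "\<not> ord c \<ge> 1" "\<not> ord (inverse c) \<ge> 1"
    using not_pos[OF fr sub(1) Y(2-4) sub(2) Y'(2-4) c(2,1)]
      not_pos[OF fr(2,1) sub(2) Y'(2-4) sub(1) Y(2-4), of "inverse c"] c(1) by auto
  then have "ord c = 0"
    using ord_inverse[OF c(1)] by linarith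
  then have eq: "Y' = Y"
    using c dilate_eq[OF sub(1) c(1), of 1] by simp
  have "scale \<pi> ` P' = ?M \<inter> Y" "scale \<pi> ` P = ?M \<inter> Y"
    using covers_Int_eq[OF F(10) sub(1)] covers_Int_eq[OF F'(10) sub(2)] Y Y' eq
      not_sub[OF fr(1) sub(1) Y(3,4)] by auto
  then show "P' = P"
    using dilate_eq_iff[OF pi_nz, of P' P] by simp
  have "\<not> Y \<subseteq> ?M"
    using covers_eq[OF F(10) sub(1) less_imp_le[OF Y(2)]] Y(2,4) by blast
  moreover have "?M \<subseteq> Q \<inter> Q'" "Y \<subseteq> Q \<inter> Q'"
    using F(4) F'(4) Y(3) Y'(3) eq by auto
  ultimately have "Q \<inter> Q' = Q" "Q \<inter> Q' = Q'"
    using covers_eq[OF F(9) submod_Int[OF F(2) F'(2)] _ Int_lower1]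
      covers_eq[OF F'(9) submod_Int[OF F(2) F'(2)] _ Int_lower2] by auto
  then show "Q' = Q" by simp
qed

lemma inj_on_image_cls_maxchains:
  assumes fr: "frame L Q P"
  shows "inj_on (\<lambda>D. cls ` D) (maxchains Q P)"
proof (rule inj_on_image)
  note F = frameD[OF fr]
  have "\<Union> (maxchains Q P) \<subseteq> {X. submod X \<and> scale \<pi> ` P \<subset> X \<and> X \<subseteq> P}"
  proof
    fix X assume "X \<in> \<Union> (maxchains Q P)"
    then obtain D where "D \<in> maxchains Q P" "X \<in> D"
      by auto
    then have "submod X" "Q \<subseteq> X" "X \<subseteq> P"
      using maxchainsD by blast+
    then show "X \<in> {X. submod X \<and> scale \<pi> ` P \<subset> X \<and> X \<subseteq> P}"
      using F(4,8) by auto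
  qed
  then show "inj_on cls (\<Union> (maxchains Q P))"
    using inj_on_cls inj_on_subset by blast
qed

text \<open>All panels arise from the same \<open>Q\<close> and \<open>P\<close>, and every maximal chain between them gives
  one.\<close>

theorem card_panels:
  assumes t: "t \<in> vertices" "t' \<in> vertices" "t \<noteq> t'" and "panels t t' \<noteq> {}"
  shows "finite (panels t t')" "card (panels t t') = flag_count q (dim V - 2)"
proof -
  obtain L where L: "lattice L" "t = cls L"
    using vertexE[OF t(1)] .
  have decomp: "\<exists>Q P D Y. frame L Q P \<and> D \<in> maxchains Q P \<and> F = cls ` D \<and> Y \<in> t' \<and> submod Y \<and>
      scale \<pi> ` P \<subset> Y \<and> Y \<subset> Q \<and> Y \<noteq> scale \<pi> ` L" if F: "F \<in> panels t t'" for F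
  proof -
    have "cham (insert (cls L) F)" "cls L \<notin> F"
      using F L(2) by (auto simp: panels_def)
    then obtain Q P D where QP: "frame L Q P" "D \<in> maxchains Q P" "F = cls ` D"
      using frame_of_cham[OF L(1)] by blast
    then obtain Y where "Y \<in> t'" "submod Y" "scale \<pi> ` P \<subset> Y" "Y \<subset> Q" "Y \<noteq> scale \<pi> ` L"
      using panel_opposite_rep[OF L(1) QP(1,2), of t'] F L(2) t(3) by blast
    then show ?thesis using QP by blast
  qed
  obtain F0 where F0: "F0 \<in> panels t t'"
    using assms(4) by blast
  obtain Q P Y where fr: "frame L Q P"
    and Y: "Y \<in> t'" "submod Y" "scale \<pi> ` P \<subset> Y" "Y \<subset> Q" "Y \<noteq> scale \<pi> ` L"
    using decomp[OF F0] by (elim exE conjE)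
  have clsY: "cls Y = t'"
    using vertex_rep(2)[OF t(2) Y(1)] .
  have "panels t t' = (\<lambda>D. cls ` D) ` maxchains Q P"
  proof (intro equalityI subsetI)
    fix F assume "F \<in> panels t t'"
    then obtain Q' P' D Y' where fr': "frame L Q' P'" "D \<in> maxchains Q' P'" "F = cls ` D"
      and Y': "Y' \<in> t'" "submod Y'" "scale \<pi> ` P' \<subset> Y'" "Y' \<subset> Q'" "Y' \<noteq> scale \<pi> ` L"
      using decomp by meson
    have "Q' = Q" "P' = P"
      using frame_unique[OF fr fr'(1) t(2) Y(1,3-5) Y'(1,3-5)] .
    then show "F \<in> (\<lambda>D. cls ` D) ` maxchains Q P"
      using fr' by blast
  next
    fix F assume "F \<in> (\<lambda>D. cls ` D) ` maxchains Q P"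
    then show "F \<in> panels t t'"
      using panel_of_opposite(3)[OF L(1) fr Y(2-5)] clsY L(2) by auto
  qed
  then show "finite (panels t t')" "card (panels t t') = flag_count q (dim V - 2)"
    using card_maxchains_frame[OF L(1) fr] card_image[OF inj_on_image_cls_maxchains[OF fr]]
    by simp_all
qed

text \<open>The possible partners of \<open>t\<close> correspond to the atoms between \<open>\<pi>P\<close> and \<open>Q\<close> other than \<open>\<pi>L\<close>.
  By the index \<open>q\<^sup>2\<close> there are \<open>q + 1\<close> atoms in total.\<close>

lemma card_opposite:
  assumes t: "t \<in> vertices" and F: "t \<notin> F" "cham (insert t F)"
  shows "card {t'. t' \<noteq> t \<and> F \<in> panels t t'} = q"
proof -
  obtain L where L: "lattice L" "t = cls L"
    using vertexE[OF t] .
  obtain Q P D where fr: "frame L Q P" and D: "D \<in> maxchains Q P" "F = cls ` D"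
    using frame_of_cham[OF L(1)] F L(2) by blast
  note FD = frameD[OF fr]
  have subP: "submod (scale \<pi> ` P)"
    using submod_dilate[OF FD(3)] .
  let ?A = "atoms (scale \<pi> ` P) Q"
  have piQP: "scale \<pi> ` P \<subseteq> Q" "index (scale \<pi> ` P) Q = q ^ 2"
    using frame_index[OF L(1) fr] by simp_all
  have pos: "index (scale \<pi> ` P) Q > 0"
    using piQP(2) q_ge_2 by simp
  have A: "finite ?A" "card ?A * (q - 1) + 1 = q ^ 2"
    using card_atoms[OF subP FD(2) piQP(1) FD(7) pos] piQP(2) by simp_all
  have "card ?A * (q - 1) = (q + 1) * (q - 1)"
    using A(2) q_ge_2 by (simp add: power2_eq_square algebra_simps)
  then have "card ?A = q + 1 \<or> q - 1 = 0"
    by (rule iffD1[OF mult_cancel2])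
  then have "card ?A = q + 1"
    using q_ge_2 by linarith
  moreover have "scale \<pi> ` L \<in> ?A"
    using FD(4,10) by (simp add: atoms_def less_imp_le)
  ultimately have card: "card (?A - {scale \<pi> ` L}) = q"
    using A(1) by simp
  have atom_iff: "Y \<in> ?A \<longleftrightarrow> submod Y \<and> scale \<pi> ` P \<subset> Y \<and> Y \<subset> Q" for Y
  proof
    assume "Y \<in> ?A"
    then have Y: "covers (scale \<pi> ` P) Y" "Y \<subseteq> Q"
      by (auto simp: atoms_def)
    have "Y \<noteq> Q"
      using covers_eq[of "scale \<pi> ` P" Q "scale \<pi> ` L"] Y(1) submod_dilate[OF FD(1)] FD(4,8) by auto
    then show "submod Y \<and> scale \<pi> ` P \<subset> Y \<and> Y \<subset> Q"
      using Y by (auto simp: covers_def)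
  next
    assume "submod Y \<and> scale \<pi> ` P \<subset> Y \<and> Y \<subset> Q"
    then show "Y \<in> ?A"
      using covers_of_index_square(1)[OF subP _ FD(2) _ _ FD(7) piQP(2)]
      by (simp add: atoms_def less_imp_le)
  qed
  have inj: "inj_on cls (?A - {scale \<pi> ` L})"
  proof (rule inj_on_subset[OF inj_on_cls[of P]], rule subsetI)
    fix Y assume "Y \<in> ?A - {scale \<pi> ` L}"
    then show "Y \<in> {X. submod X \<and> scale \<pi> ` P \<subset> X \<and> X \<subseteq> P}"
      using atom_iff FD(5) by auto
  qed
  have "{t'. t' \<noteq> t \<and> F \<in> panels t t'} = cls ` (?A - {scale \<pi> ` L})"
  proof (intro equalityI subsetI)
    fix t' assume "t' \<in> {t'. t' \<noteq> t \<and> F \<in> panels t t'}"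
    then have t': "cls L \<noteq> t'" "cls ` D \<in> panels (cls L) t'"
      using D(2) L(2) by auto
    then obtain Y where Y: "Y \<in> t'" "submod Y" "scale \<pi> ` P \<subset> Y" "Y \<subset> Q" "Y \<noteq> scale \<pi> ` L"
      using panel_opposite_rep[OF L(1) fr D(1)] by blast
    have "t' \<in> vertices"
      using t'(2) cham_simplex simplexD(1) by (auto simp: panels_def)
    then have "cls Y = t'"
      using vertex_rep(2) Y(1) by simp
    then show "t' \<in> cls ` (?A - {scale \<pi> ` L})"
      using Y(2-5) atom_iff[of Y] by (intro image_eqI[of _ _ Y]) simp_all
  next
    fix t' assume "t' \<in> cls ` (?A - {scale \<pi> ` L})"
    then obtain Y where Y: "t' = cls Y" "Y \<in> ?A" "Y \<noteq> scale \<pi> ` L"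
      by blast
    then have Y': "submod Y" "scale \<pi> ` P \<subset> Y" "Y \<subset> Q"
      using atom_iff[of Y] by simp_all
    show "t' \<in> {t'. t' \<noteq> t \<and> F \<in> panels t t'}"
      using panel_of_opposite[OF L(1) fr Y' Y(3)] D L(2) Y(1) by simp
  qed
  then show ?thesis
    using card card_image[OF inj] by simp
qed


section \<open>Counting galleries and close vertices\<close>

lemma adjacent_iff:
  "adjacent ord \<pi> scale V C C' \<longleftrightarrow>
     (\<exists>s s' F. s \<noteq> s' \<and> F \<in> panels s s' \<and> C = insert s F \<and> C' = insert s' F)"
proof
  assume adj: "adjacent ord \<pi> scale V C C'"
  then have C: "cham C" "cham C'" "C \<noteq> C'"
    by (simp_all add: adjacent_def)
  obtain F where F: "F \<subseteq> C" "F \<subseteq> C'" "card F + 1 = card C" "card F + 1 = card C'"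
    using adj unfolding adjacent_def by (elim conjE exE)
  have fin: "finite C" "finite C'"
    using simplexD(3)[OF cham_simplex] C(1,2) by simp_all
  have "card (C - F) = 1" "card (C' - F) = 1"
    using F fin by (simp_all add: card_Diff_subset finite_subset)
  then obtain s s' where s: "C - F = {s}" "C' - F = {s'}"
    by (meson card_1_singletonE)
  then have "C = insert s F" "C' = insert s' F" "s \<notin> F" "s' \<notin> F"
    using F by auto
  then show "\<exists>s s' F. s \<noteq> s' \<and> F \<in> panels s s' \<and> C = insert s F \<and> C' = insert s' F"
    using C by (intro exI[of _ s] exI[of _ s'] exI[of _ F]) (auto simp: panels_def)
next
  assume "\<exists>s s' F. s \<noteq> s' \<and> F \<in> panels s s' \<and> C = insert s F \<and> C' = insert s' F"
  then obtain s s' F where s: "s \<noteq> s'" "F \<in> panels s s'" "C = insert s F" "C' = insert s' F"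
    by blast
  then have F: "cham C" "cham C'" "s \<notin> F" "s' \<notin> F"
    by (auto simp: panels_def)
  have "finite C"
    using simplexD(3)[OF cham_simplex] F(1) by simp
  then have "finite F"
    using s(3) by simp
  then show "adjacent ord \<pi> scale V C C'"
    unfolding adjacent_def using s F by (intro conjI exI[of _ F]) auto
qed

lemma close_iff: "close_vertices ord \<pi> scale V t t' \<longleftrightarrow> t \<noteq> t' \<and> panels t t' \<noteq> {}"
proof
  assume "close_vertices ord \<pi> scale V t t'"
  then obtain C C' where C: "adjacent ord \<pi> scale V C C'" "t \<in> C" "t' \<in> C'"
      "t \<notin> C \<inter> C'" "t' \<notin> C \<inter> C'"
    by (auto simp: close_vertices_def)
  then obtain s s' F where s: "s \<noteq> s'" "F \<in> panels s s'" "C = insert s F" "C' = insert s' F"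
    using adjacent_iff by auto
  then have "t = s" "t' = s'"
    using C by auto
  then show "t \<noteq> t' \<and> panels t t' \<noteq> {}"
    using s by auto
next
  assume "t \<noteq> t' \<and> panels t t' \<noteq> {}"
  then obtain F where F: "t \<noteq> t'" "F \<in> panels t t'"
    by blast
  then have "adjacent ord \<pi> scale V (insert t F) (insert t' F)"
    unfolding adjacent_iff by (intro exI[of _ t] exI[of _ t'] exI[of _ F]) simp
  moreover have "t \<notin> insert t F \<inter> insert t' F" "t' \<notin> insert t F \<inter> insert t' F"
    using F by (auto simp: panels_def)
  ultimately show "close_vertices ord \<pi> scale V t t'"
    unfolding close_vertices_def
    by (intro exI[of _ "insert t F"] exI[of _ "insert t' F"]) simp
qed

text \<open>The close vertices \<open>t\<close> and \<open>t'\<close> lie in no common chamber, so the two chambers of a gallery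
  differ precisely in them.\<close>

lemma galleries_between_eq:
  assumes neq: "t \<noteq> t'" and ne: "panels t t' \<noteq> {}"
  shows "galleries_between ord \<pi> scale V t t' = (\<lambda>F. (insert t F, insert t' F)) ` panels t t'"
proof (intro equalityI subsetI)
  have not_both: "\<not> (t \<in> C \<and> t' \<in> C)" if "cham C" for C
  proof
    assume "t \<in> C \<and> t' \<in> C"
    then have "inc t t' \<and> inc t' t"
      using simplexD(2)[OF cham_simplex[OF that]] neq by simp
    then show False
      using ne panels_not_incident[OF _ neq] by blast
  qed
  fix g assume "g \<in> galleries_between ord \<pi> scale V t t'"
  then obtain C C' where g: "g = (C, C')" "adjacent ord \<pi> scale V C C'" "t \<in> C" "t' \<in> C'"
    by (auto simp: galleries_between_def)
  then obtain s s' F where s: "s \<noteq> s'" "F \<in> panels s s'" "C = insert s F" "C' = insert s' F"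
    using adjacent_iff by auto
  have "cham C" "cham C'"
    using g(2) by (auto simp: adjacent_def)
  then have "t \<notin> C'" "t' \<notin> C"
    using not_both g(3,4) by blast+
  then have "t = s" "t' = s'"
    using g(3,4) s by auto
  then show "g \<in> (\<lambda>F. (insert t F, insert t' F)) ` panels t t'"
    using g(1) s by blast
next
  fix g assume "g \<in> (\<lambda>F. (insert t F, insert t' F)) ` panels t t'"
  then show "g \<in> galleries_between ord \<pi> scale V t t'"
    unfolding galleries_between_def adjacent_iff using neq by blast
qed

theorem card_galleries_between:
  assumes t: "t \<in> vertices" "t' \<in> vertices" and close: "close_vertices ord \<pi> scale V t t'"
  shows "finite (galleries_between ord \<pi> scale V t t')"
    and "card (galleries_between ord \<pi> scale V t t') = flag_count q (dim V - 2)"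
proof -
  have c: "t \<noteq> t'" "panels t t' \<noteq> {}"
    using close close_iff by auto
  have "inj_on (\<lambda>F. (insert t F, insert t' F)) (panels t t')"
  proof (rule inj_onI)
    fix F G assume "F \<in> panels t t'" "G \<in> panels t t'"
      and "(insert t F, insert t' F) = (insert t G, insert t' G)"
    then show "F = G"
      using insert_ident[of t F G] by (simp add: panels_def)
  qed
  then show "finite (galleries_between ord \<pi> scale V t t')"
    and "card (galleries_between ord \<pi> scale V t t') = flag_count q (dim V - 2)"
    using galleries_between_eq[OF c] card_panels[OF t c] by (simp_all add: card_image)
qed

text \<open>Double counting of the pairs of a panel \<open>F\<close> completed by \<open>t\<close> and a vertex \<open>t' \<noteq> t\<close> that
  completes \<open>F\<close> as well.\<close>

theorem card_vertices_close_to: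
  assumes t: "t \<in> vertices"
  shows "finite (vertices_close_to ord \<pi> scale V t)"
    and "card (vertices_close_to ord \<pi> scale V t) * flag_count q (dim V - 2) =
      flag_count q (dim V) * q"
proof -
  let ?N = "vertices_close_to ord \<pi> scale V t"
  define Fs where "Fs = {F. t \<notin> F \<and> cham (insert t F)}"
  define opp where "opp F = {t'. t' \<noteq> t \<and> F \<in> panels t t'}" for F
  obtain L where L: "lattice L" "t = cls L"
    using vertexE[OF t] .
  have bij: "bij_betw (insert t) Fs (chambers_containing ord \<pi> scale V t)"
    by (rule bij_betw_byWitness[of _ "\<lambda>C. C - {t}"])
      (auto simp: Fs_def chambers_containing_def insert_absorb)
  have Fs: "finite Fs" "card Fs = flag_count q (dim V)"
    using card_chambers_containing[OF L(1)] bij_betw_finite[OF bij] bij_betw_same_card[OF bij]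
    unfolding L(2) by simp_all
  have opp: "card (opp F) = q" "finite (opp F)" if "F \<in> Fs" for F
  proof -
    show "card (opp F) = q"
      using card_opposite[OF t, of F] that by (simp add: Fs_def opp_def)
    then show "finite (opp F)"
      using q_ge_2 by (intro card_ge_0_finite) simp
  qed
  have N: "?N = {t'. t' \<noteq> t \<and> panels t t' \<noteq> {}}"
  proof -
    have "t' \<in> vertices" if "panels t t' \<noteq> {}" for t'
      using that cham_simplex simplexD(1) by (force simp: panels_def)
    then show ?thesis
      by (auto simp: vertices_close_to_def close_iff)
  qed
  have swap: "Sigma ?N (panels t) = prod.swap ` Sigma Fs opp"
    unfolding N by (auto simp: Fs_def opp_def panels_def image_iff)
  have "?N = fst ` Sigma ?N (panels t)"
    unfolding N by force
  then show fin: "finite ?N"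
    unfolding swap using Fs(1) opp(2) by (metis finite_SigmaI finite_imageI)
  have "(\<Sum>t'\<in>?N. card (panels t t')) = card (Sigma ?N (panels t))"
    using fin card_panels[OF t] by (intro card_SigmaI[symmetric])
      (auto simp: vertices_close_to_def close_iff)
  also have "\<dots> = card (Sigma Fs opp)"
    unfolding swap by (intro card_image) simp
  also have "\<dots> = (\<Sum>F\<in>Fs. card (opp F))"
    using Fs(1) opp(2) by (intro card_SigmaI) auto
  also have "\<dots> = flag_count q (dim V) * q"
    using opp(1) Fs(2) by simp
  finally show "card ?N * flag_count q (dim V - 2) = flag_count q (dim V) * q"
    using card_panels(2)[OF t] by (simp add: vertices_close_to_def close_iff)
qed

end


section \<open>The numbers of chambers of the coordinate buildings\<close>

lemma vector_space_coord: "vector_space (coord_scale :: 'k::field \<Rightarrow> (nat \<Rightarrow> 'k) \<Rightarrow> nat \<Rightarrow> 'k)"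
  by unfold_locales (auto simp: coord_scale_def fun_eq_iff algebra_simps)

definition std_basis :: "nat \<Rightarrow> (nat \<Rightarrow> 'k::field) set" where
  "std_basis m = (\<lambda>i j. if j = i then 1 else 0) ` {..<m}"

lemma std_basis_sum:
  fixes a :: "(nat \<Rightarrow> 'k::field) \<Rightarrow> 'k"
  shows "(\<Sum>b\<in>std_basis m. coord_scale (a b) b) =
    (\<lambda>j. if j < m then a (\<lambda>k. if k = j then 1 else 0) else 0)"
proof -
  have "inj_on (\<lambda>i j. if j = i then 1 else (0::'k)) {..<m}"
    by (rule inj_onI) (metis zero_neq_one)
  then have "(\<Sum>b\<in>std_basis m. coord_scale (a b) b) =
      (\<Sum>i<m. coord_scale (a (\<lambda>j. if j = i then 1 else 0)) (\<lambda>j. if j = i then 1 else 0))"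
    by (simp add: std_basis_def sum.reindex)
  also have "\<dots> = (\<lambda>j. if j < m then a (\<lambda>k. if k = j then 1 else 0) else 0)"
  proof
    fix j
    have "(\<Sum>i<m. coord_scale (a (\<lambda>j. if j = i then 1 else 0)) (\<lambda>j. if j = i then 1 else 0)) j =
        (\<Sum>i<m. if j = i then a (\<lambda>k. if k = i then 1 else 0) else 0)"
      by (induction m) (auto simp: coord_scale_def)
    then show "(\<Sum>i<m. coord_scale (a (\<lambda>j. if j = i then 1 else 0)) (\<lambda>j. if j = i then 1 else 0)) j =
        (if j < m then a (\<lambda>k. if k = j then 1 else 0) else 0)"
      by simp
  qed
  finally show ?thesis .
qed

lemma card_std_basis: "finite (std_basis m)" "card (std_basis m :: (nat \<Rightarrow> 'k::field) set) = m"
proof -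
  have "inj_on (\<lambda>i j. if j = i then 1 else (0::'k)) {..<m}"
    by (rule inj_onI) (metis zero_neq_one)
  then show "card (std_basis m :: (nat \<Rightarrow> 'k) set) = m"
    by (simp add: std_basis_def card_image)
qed (simp add: std_basis_def)

lemma std_basis_subset: "std_basis m \<subseteq> coord_space m"
  by (auto simp: std_basis_def coord_space_def)

lemma std_basis_sum_eq_0D:
  assumes "(\<Sum>b\<in>std_basis m. coord_scale (a b) b) = 0" "b \<in> std_basis m"
  shows "a b = 0"
proof -
  obtain i where "i < m" "b = (\<lambda>j. if j = i then 1 else 0)"
    using assms(2) by (auto simp: std_basis_def)
  then show ?thesis
    using fun_cong[OF assms(1)[unfolded std_basis_sum], of i] by simp
qed

lemma dim_coord_space: "vector_space.dim coord_scale (coord_space m :: (nat \<Rightarrow> 'k::field) set) = m"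
proof -
  interpret vector_space "coord_scale :: 'k \<Rightarrow> (nat \<Rightarrow> 'k) \<Rightarrow> nat \<Rightarrow> 'k"
    by (rule vector_space_coord)
  let ?B = "std_basis m :: (nat \<Rightarrow> 'k) set"
  have "independent ?B"
    unfolding independent_explicit_finite_subsets
  proof (intro allI impI ballI)
    fix A :: "(nat \<Rightarrow> 'k) set" and u v
    assume A: "A \<subseteq> ?B" "finite A" "(\<Sum>v\<in>A. coord_scale (u v) v) = 0" "v \<in> A"
    have "(\<Sum>v\<in>?B. coord_scale (if v \<in> A then u v else 0) v) = (\<Sum>v\<in>A. coord_scale (u v) v)"
      using A(1) card_std_basis(1) by (intro sum.mono_neutral_cong_right) auto
    then have "(\<Sum>v\<in>?B. coord_scale (if v \<in> A then u v else 0) v) = 0"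
      using A(3) by simp
    from std_basis_sum_eq_0D[OF this, of v] show "u v = 0"
      using A by auto
  qed
  moreover have "coord_space m \<subseteq> span ?B"
  proof
    fix f :: "nat \<Rightarrow> 'k" assume f: "f \<in> coord_space m"
    have "f = (\<Sum>b\<in>?B. coord_scale (\<Sum>i<m. f i * b i) b)"
      unfolding std_basis_sum
    proof
      fix j
      show "f j = (if j < m then \<Sum>i<m. f i * (if i = j then 1 else 0) else 0)"
        using f by (simp add: coord_space_def if_distrib cong: if_cong)
    qed
    also have "\<dots> \<in> span ?B"
      by (intro span_sum span_scale span_base)
    finally show "f \<in> span ?B" .
  qed
  ultimately show ?thesis
    using dim_unique[OF std_basis_subset] card_std_basis(2) by metis
qed

lemma subspace_coord_space: "module.subspace coord_scale (coord_space m :: (nat \<Rightarrow> 'k::field) set)"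
proof -
  interpret vector_space "coord_scale :: 'k \<Rightarrow> (nat \<Rightarrow> 'k) \<Rightarrow> nat \<Rightarrow> 'k"
    by (rule vector_space_coord)
  show ?thesis
    by (rule subspaceI) (auto simp: coord_space_def coord_scale_def)
qed

lemma std_lattice:
  fixes ord :: "'k::field \<Rightarrow> int"
  shows "\<exists>L. is_lattice ord coord_scale (coord_space m) L"
proof (intro exI)
  show "is_lattice ord coord_scale (coord_space m)
      {\<Sum>b\<in>std_basis m. coord_scale (a b) b | a. a ` std_basis m \<subseteq> valuation_ring ord}"
    unfolding is_lattice_def dim_coord_space
  proof (intro exI[of _ "std_basis m"] conjI allI impI ballI)
    show "a b = 0" if "(\<Sum>b\<in>std_basis m. coord_scale (a b) b) = 0" "b \<in> std_basis m"
      for a :: "(nat \<Rightarrow> 'k) \<Rightarrow> 'k" and b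
      using std_basis_sum_eq_0D[OF that] .
  qed (rule card_std_basis std_basis_subset refl)+
qed

text \<open>The definite description in \<open>r_num\<close> has a value only because the building has a vertex; the
  standard lattice supplies one. For \<open>m = 1\<close> the value \<open>1\<close> fixed by convention is the number of
  complete flags of a line.\<close>

theorem r_num_eq:
  fixes ord :: "'k::field \<Rightarrow> int"
  assumes ord: "nonarch_local_field ord" and \<pi>: "uniformizer ord \<pi>" and m: "m \<ge> 1"
  shows "r_num ord \<pi> m = flag_count (card (residue_field ord)) m"
proof (cases "m = 1")
  case True
  then show ?thesis
    using flag_count_1[OF nonarch_local_field.q_ge_2[OF ord]] by (simp add: r_num_def)
next
  case False
  interpret building ord coord_scale \<pi> "coord_space m"
    using ord \<pi> vector_space_coord[where 'k = 'k] subspace_coord_space[where 'k = 'k, of m]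
      dim_coord_space[where 'k = 'k, of m] False m
    by (simp add: building_def building_axioms_def lattice_space_def lattice_space_axioms_def)
  have vert: "finite (chambers_containing ord \<pi> coord_scale (coord_space m) t) \<and>
      card (chambers_containing ord \<pi> coord_scale (coord_space m) t) = flag_count q m"
    if "t \<in> vertices" for t
    using card_chambers_containing vertexE[OF that] dim_coord_space[of m] by metis
  obtain t where t: "t \<in> vertices"
    using std_lattice cls_vertex by blast
  have "(THE N. \<forall>t\<in>vertices. finite (chambers_containing ord \<pi> coord_scale (coord_space m) t) \<and>
      card (chambers_containing ord \<pi> coord_scale (coord_space m) t) = N) = flag_count q m"
    using vert t by (intro the_equality) auto
  then show ?thesis
    using False by (simp add: r_num_def)
qed


section \<open>Galleries between close vertices and the numbers \<open>r\<^sub>m\<close>\<close>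

theorem theorem1p2:
  fixes ord :: "'k::field \<Rightarrow> int" and \<pi> :: 'k and q :: nat
    and scale :: "'k \<Rightarrow> 'v::ab_group_add \<Rightarrow> 'v" and V :: "'v set" and n :: nat
  assumes "nonarch_local_field ord"
    and "uniformizer ord \<pi>"
    and "q = card (residue_field ord)"
    and "vector_space scale"
    and "module.subspace scale V"
    and "vector_space.dim scale V = n"
    and "n \<ge> 3"
  shows "(\<forall>t \<in> building_vertices ord scale V. \<forall>t' \<in> building_vertices ord scale V.
            close_vertices ord \<pi> scale V t t' \<longrightarrow>
              finite (galleries_between ord \<pi> scale V t t') \<and>
              card (galleries_between ord \<pi> scale V t t') = r_num ord \<pi> (n - 2)) \<and>
         (\<forall>t \<in> building_vertices ord scale V.
            finite (vertices_close_to ord \<pi> scale V t) \<and>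
            real (card (vertices_close_to ord \<pi> scale V t)) =
              real (r_num ord \<pi> n * q) / real (r_num ord \<pi> (n - 2)))"
proof -
  interpret building ord scale \<pi> V
    using assms(1,2,4-7)
    by (simp add: building_def building_axioms_def lattice_space_def lattice_space_axioms_def)
  have r: "r_num ord \<pi> n = flag_count q n" "r_num ord \<pi> (n - 2) = flag_count q (n - 2)"
    unfolding assms(3) using assms(7) by (auto intro!: r_num_eq[OF assms(1,2)])
  have "flag_count q (n - 2) > 0"
    using flag_count_pos q_ge_2 assms(3) by simp
  then have "real N = real (flag_count q n * q) / real (flag_count q (n - 2))"
    if "N * flag_count q (n - 2) = flag_count q n * q" for N
    unfolding that[symmetric] by simp
  then show ?thesis
    using card_galleries_between card_vertices_close_to assms(3,6) r by auto
qed

end
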